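(* Let $\{(X(t),\varphi(t))\}$ be a Markov-modulated fluid flow with irreducible phase generator $Q$ on the finite set $\mathcal S$ and rate vector $\boldsymbol c$, and let $a,b\ge 0$. If the stationary drift $\mu=\boldsymbol\alpha^{T}\boldsymbol c$ equals $0$, then the escape probability matrices from $(-a,b)$ satisfy $$\begin{bmatrix}B_{++}^{(a,b)} & A_{+-}^{(a,b)}\\ B_{-+}^{(a,b)} & A_{--}^{(a,b)}\end{bmatrix}\boldsymbol\beta=\begin{bmatrix}\boldsymbol h_+\\ \boldsymbol h_-\end{bmatrix},$$ where $\boldsymbol h=-Q^{\#}\boldsymbol c$, $Q^{\#}$ is the group inverse of $Q$, and $$\boldsymbol\beta=\begin{bmatrix} b\,\boldsymbol 1_+ +\boldsymbol h_+\\ -a\,\boldsymbol 1_- +\boldsymbol h_-\end{bmatrix}.$$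
   Context: Fluid flow: $\{\varphi(t):t\ge 0\}$ is a continuous-time irreducible Markov chain (the phase) on a finite set $\mathcal S$ with generator $Q$; $\boldsymbol c=[c_i:i\in\mathcal S]$ is a vector of arbitrary real constants, and $X(t)=X(0)+\int_0^t c_{\varphi(s)}\,ds$ (the level). Let $\mathcal S_+=\{i:c_i>0\}$, $\mathcal S_-=\{i:c_i<0\}$, $\mathcal S_0=\{i:c_i=0\}$, with $\mathcal S_+$ and $\mathcal S_-$ nonempty. For a vector $\boldsymbol v$ indexed by $\mathcal S$, $\boldsymbol v_+$ and $\boldsymbol v_-$ denote its subvectors indexed by $\mathcal S_+$ and $\mathcal S_-$; matrix sub-blocks are denoted similarly (e.g. $M_{+-}$ has rows in $\mathcal S_+$ and columns in $\mathcal S_-$). $\boldsymbol 1$ is a vector of ones. $\boldsymbol\alpha$ is the stationary probability vector of $Q$: $\boldsymbol\alpha^{T}Q=\boldsymbol 0$, $\boldsymbol\alpha^{T}\boldsymbol 1=1$. The group inverse $Q^{\#}$ is the unique matrix with $Q^{\#}Q=I-\boldsymbol 1\boldsymbol\alpha^{T}$ and $Q^{\#}\boldsymbol 1=\boldsymbol 0$. For $x\ge 0$ let $\tau_x^-=\inf\{t:X(t)<X(0)-x\}$ and $\tau_x^+=\inf\{t:X(t)>X(0)+x\}$. The escape probability matrices are $A^{(a,b)}_{ij}=P[\tau_a^-<\tau_b^+,\ \varphi(\tau_a^-)=j\mid X(0)=0,\varphi(0)=i]$ for $i\in\mathcal S$, $j\in\mathcal S_-$, and $B^{(a,b)}_{ij}=P[\tau_b^+<\tau_a^-,\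 \varphi(\tau_b^+)=j\mid X(0)=0,\varphi(0)=i]$ for $i\in\mathcal S$, $j\in\mathcal S_+$. $A^{(a,b)}$ is partitioned into row blocks $A_{+-}^{(a,b)},A_{--}^{(a,b)},A_{0-}^{(a,b)}$ and $B^{(a,b)}$ into $B_{++}^{(a,b)},B_{-+}^{(a,b)},B_{0+}^{(a,b)}$, according to the initial phase being in $\mathcal S_+,\mathcal S_-,\mathcal S_0$. *)

theory Defs
  imports "HOL-Probability.Probability"
begin

text \<open>
  The phase space is a finite type \<open>'s\<close>; matrices and vectors indexed by it are
  \<^typ>\<open>real^'s^'s\<close> and \<^typ>\<open>real^'s\<close>. Row \<open>i\<close>, column \<open>j\<close> of \<open>M\<close> is \<open>M $ i $ j\<close>.
\<close>

subsection \<open>Generators\<close>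

definition generator_matrix :: "real^'s^'s \<Rightarrow> bool" where
  "generator_matrix Q \<longleftrightarrow>
     (\<forall>i j. i \<noteq> j \<longrightarrow> 0 \<le> Q $ i $ j) \<and> (\<forall>i. (\<Sum>j\<in>UNIV. Q $ i $ j) = 0)"

definition irreducible_generator :: "real^'s^'s \<Rightarrow> bool" where
  "irreducible_generator Q \<longleftrightarrow>
     generator_matrix Q \<and> (\<forall>i j. (i, j) \<in> {(k, l). k \<noteq> l \<and> 0 < Q $ k $ l}\<^sup>*)"

definition stationary_vector :: "real^'s^'s \<Rightarrow> real^'s \<Rightarrow> bool" where
  "stationary_vector Q \<alpha> \<longleftrightarrow>
     \<alpha> v* Q = 0 \<and> (\<forall>i. 0 \<le> \<alpha> $ i) \<and> (\<Sum>i\<in>UNIV. \<alpha> $ i) = 1"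

text \<open>
  For an irreducible generator with stationary vector \<open>\<alpha>\<close>, exactly one matrix satisfies the two
  equations below. The matrix with entries \<open>\<alpha> $ j\<close> is the product of the column of ones with the
  row \<open>\<alpha>\<close>.
\<close>

definition group_inverse :: "real^'s^'s \<Rightarrow> real^'s \<Rightarrow> real^'s^'s \<Rightarrow> bool" where
  "group_inverse Q \<alpha> G \<longleftrightarrow>
     G ** Q = mat 1 - (\<chi> i j. \<alpha> $ j) \<and> G *v (\<chi> i. 1) = 0"

subsection \<open>Continuous-time Markov chains\<close>

text \<open>
  Multiplication on vector types is not the matrix product, so the library's \<^const>\<open>exp\<close> and
  \<^const>\<open>power\<close> are not the matrix operations.
\<close>

definition matrix_exp :: "real^'s^'s \<Rightarrow> real^'s^'s" where
  "matrix_exp A = (\<Sum>n. (1 / fact n) *\<^sub>R (((\<lambda>B. A ** B) ^^ n) (mat 1)))"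

text \<open>The events of the natural filtration of \<open>\<phi>\<close> at time \<open>t\<close>.\<close>

definition history :: "'w measure \<Rightarrow> (real \<Rightarrow> 'w \<Rightarrow> 's) \<Rightarrow> real \<Rightarrow> 'w set set" where
  "history M \<phi> t =
     sigma_sets (space M) {{\<omega> \<in> space M. \<phi> u \<omega> = k} | u k. 0 \<le> u \<and> u \<le> t}"

text \<open>
  The last conjunct is the Markov property, with transition matrices \<open>exp (t Q)\<close>, written without
  conditional probabilities so that states of probability zero need no separate treatment.
  Only times \<open>t \<ge> 0\<close> are meaningful. The initial distribution is arbitrary.
\<close>

definition markov_chain :: "real^'s^'s \<Rightarrow> 'w measure \<Rightarrow> (real \<Rightarrow> 'w \<Rightarrow> 's) \<Rightarrow> bool" where
  "markov_chain Q M \<phi> \<longleftrightarrow>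
     prob_space M \<and>
     (\<forall>t\<ge>0. \<phi> t \<in> M \<rightarrow>\<^sub>M count_space UNIV) \<and>
     (\<forall>\<omega>\<in>space M. \<forall>t\<ge>0. \<forall>\<^sub>F s in at_right t. \<phi> s \<omega> = \<phi> t \<omega>) \<and>
     (\<forall>s\<ge>0. \<forall>t\<ge>0. \<forall>E\<in>history M \<phi> s. \<forall>i j.
        measure M {\<omega> \<in> E. \<phi> s \<omega> = i \<and> \<phi> (s + t) \<omega> = j} =
        measure M {\<omega> \<in> E. \<phi> s \<omega> = i} * matrix_exp (t *\<^sub>R Q) $ i $ j)"

subsection \<open>Fluid flows and escape probabilities\<close>

definition fluid_flow ::
  "real^'s^'s \<Rightarrow> real^'s \<Rightarrow> 'w measure \<Rightarrow> (real \<Rightarrow> 'w \<Rightarrow> real) \<Rightarrow> (real \<Rightarrow> 'w \<Rightarrow> 's) \<Rightarrow> bool" where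
  "fluid_flow Q c M X \<phi> \<longleftrightarrow>
     markov_chain Q M \<phi> \<and>
     X 0 \<in> borel_measurable M \<and>
     (\<forall>\<omega>\<in>space M. \<forall>t\<ge>0. X t \<omega> = X 0 \<omega> + (LBINT s:{0..t}. c $ \<phi> s \<omega>))"

text \<open>
  Conditioning on \<open>X(0) = 0, \<phi>(0) = i\<close> is expressed, as usual for Markov processes, by a family of
  laws: \<open>P i\<close> is the law under which the flow starts in \<open>(0, i)\<close>.
\<close>

definition fluid_flow_family ::
  "real^'s^'s \<Rightarrow> real^'s \<Rightarrow> ('s \<Rightarrow> 'w measure) \<Rightarrow> (real \<Rightarrow> 'w \<Rightarrow> real) \<Rightarrow> (real \<Rightarrow> 'w \<Rightarrow> 's) \<Rightarrow> bool" where
  "fluid_flow_family Q c P X \<phi> \<longleftrightarrow>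
     (\<forall>i. fluid_flow Q c (P i) X \<phi> \<and> (AE \<omega> in P i. X 0 \<omega> = 0 \<and> \<phi> 0 \<omega> = i))"

text \<open>Passage times are extended reals; the infimum over the empty set is \<open>\<infinity>\<close>.\<close>

definition tau_down :: "(real \<Rightarrow> 'w \<Rightarrow> real) \<Rightarrow> real \<Rightarrow> 'w \<Rightarrow> ereal" where
  "tau_down X x \<omega> = (INF t\<in>{t. 0 \<le> t \<and> X t \<omega> < X 0 \<omega> - x}. ereal t)"

definition tau_up :: "(real \<Rightarrow> 'w \<Rightarrow> real) \<Rightarrow> real \<Rightarrow> 'w \<Rightarrow> ereal" where
  "tau_up X x \<omega> = (INF t\<in>{t. 0 \<le> t \<and> X t \<omega> > X 0 \<omega> + x}. ereal t)"

text \<open>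
  In both definitions the strict inequality forces the passage time at which the phase is evaluated
  to be finite.
\<close>

definition escape_A ::
  "('s \<Rightarrow> 'w measure) \<Rightarrow> (real \<Rightarrow> 'w \<Rightarrow> real) \<Rightarrow> (real \<Rightarrow> 'w \<Rightarrow> 's) \<Rightarrow> real \<Rightarrow> real \<Rightarrow> 's \<Rightarrow> 's \<Rightarrow> real" where
  "escape_A P X \<phi> a b i j =
     measure (P i) {\<omega> \<in> space (P i).
       tau_down X a \<omega> < tau_up X b \<omega> \<and> \<phi> (real_of_ereal (tau_down X a \<omega>)) \<omega> = j}"

definition escape_B ::
  "('s \<Rightarrow> 'w measure) \<Rightarrow> (real \<Rightarrow> 'w \<Rightarrow> real) \<Rightarrow> (real \<Rightarrow> 'w \<Rightarrow> 's) \<Rightarrow> real \<Rightarrow> real \<Rightarrow> 's \<Rightarrow> 's \<Rightarrow> real" where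
  "escape_B P X \<phi> a b i j =
     measure (P i) {\<omega> \<in> space (P i).
       tau_up X b \<omega> < tau_down X a \<omega> \<and> \<phi> (real_of_ereal (tau_up X b \<omega>)) \<omega> = j}"

definition S_plus :: "real^'s \<Rightarrow> 's set" where
  "S_plus c = {i. c $ i > 0}"

definition S_minus :: "real^'s \<Rightarrow> 's set" where
  "S_minus c = {i. c $ i < 0}"

end

theory Submission
  imports Defs
begin

text \<open>
  Since \<open>\<alpha> \<bullet> c = 0\<close>, the vector \<open>h\<close> solves the Poisson equation \<open>Q h = -c\<close>, so the level plus
  \<open>h\<close> at the current phase is a martingale. Stopped at the exit from \<open>[-a, b]\<close> it is bounded, and the
  exit time is almost surely finite because in every period of a fixed length the phase has, whatever
  the past, a probability bounded away from \<open>0\<close> of settling in one phase of positive rate for long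
  enough to leave the interval. At the exit the level is \<open>b\<close> or \<open>-a\<close> according to the sign of the
  rate of the current phase, so the stopped martingale equals \<open>\<beta>\<close> there and optional stopping gives
  the claim. Optional stopping is reduced to finite sums by rounding the exit time up to a grid.
\<close>

subsection \<open>The Poisson equation and the matrix exponential\<close>

text \<open>The Markov property is available only at deterministic times, for events of the natural
  filtration, and no conditional expectation is formed. The exit time of a closed interval fits this
  filtration badly: whether the exit happens at t is decided just after t. But whether s is at most
  the exit time is decided by the path before s. A martingale increment over a grid cell, weighted
  by that event at the left end of the cell, therefore has mean zero, and the weighted increments
  telescope to the martingale at the grid point following the exit. The rounding must go upwards
  because the phase is only right constant: approached from the right, the rounded times eventually
  carry the phase of the exit itself, whereas from the left they may carry another one. Phases of
  rate zero get no column because a path cannot leave the interval while its level stands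
  still.\<close>

lemma group_inverse_solves_Poisson:
  fixes Q G :: "real^'s^'s" and c \<alpha> :: "real^'s"
  assumes st: "stationary_vector Q \<alpha>" and gi: "group_inverse Q \<alpha> G" and c: "\<alpha> \<bullet> c = 0"
  shows "Q *v (G *v c) = c"
proof -
  let ?one = "(\<chi> i. 1) :: real^'s"
  \<comment> \<open>Only the product \<open>G ** Q\<close> is prescribed, so the effect of
    \<open>Q ** G\<close> on c has to be derived. Q plus the rank-one matrix with rows \<alpha> is
    injective, hence onto. A preimage y of c satisfies \<alpha> \<bullet> y = \<alpha> \<bullet> c =
    0, so c = Q y and G c = y.\<close>
  define R where "R = Q + (\<chi> i j. \<alpha> $ j)"
  have one_mult: "(\<chi> i. \<alpha>) *v x = (\<alpha> \<bullet> x) *\<^sub>R ?one" for x :: "real^'s"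
    by (simp add: vec_eq_iff matrix_vector_mult_def inner_vec_def)
  have R: "R *v x = Q *v x + (\<alpha> \<bullet> x) *\<^sub>R ?one" for x
    by (simp add: R_def matrix_vector_mult_add_rdistrib one_mult)
  have GQ: "G *v (Q *v x) = x - (\<alpha> \<bullet> x) *\<^sub>R ?one" for x
    using gi by (simp add: group_inverse_def matrix_vector_mul_assoc matrix_vector_mult_diff_rdistrib one_mult)
  have \<alpha>Q: "\<alpha> \<bullet> (Q *v x) = 0" for x
    using st by (simp add: stationary_vector_def dot_lmul_matrix [symmetric])
  have \<alpha>1: "\<alpha> \<bullet> ?one = 1"
    using st by (simp add: stationary_vector_def inner_vec_def)
  have \<alpha>R: "\<alpha> \<bullet> (R *v x) = \<alpha> \<bullet> x" for x
    by (simp add: R inner_add_right \<alpha>Q \<alpha>1)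
  have "inj ((*v) R)"
  proof (rule injI)
    fix x y assume "R *v x = R *v y"
    then have 0: "R *v (x - y) = 0"
      by (simp add: matrix_vector_mult_diff_distrib)
    then have a: "\<alpha> \<bullet> (x - y) = 0"
      by (metis \<alpha>R inner_zero_right)
    then have "Q *v (x - y) = 0" using 0 R by simp
    then have "x - y = 0" using GQ[of "x - y"] a by simp
    then show "x = y" by simp
  qed
  then have "surj ((*v) R)"
    by (intro linear_injective_imp_surjective) auto
  then obtain y where y: "c = R *v y" by (metis surjD)
  then have "\<alpha> \<bullet> y = 0" using \<alpha>R c by simp
  then have "c = Q *v y" "G *v c = y" using y R GQ by auto
  then show ?thesis by simp
qed

section \<open>Matrix powers and the exponential series, entry by entry\<close>

definition mpow :: "real^'s^'s \<Rightarrow> nat \<Rightarrow> real^'s^'s" where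
  "mpow A n = ((\<lambda>B. A ** B) ^^ n) (mat 1)"

lemma mpow_0: "mpow A 0 = mat 1"
  and mpow_Suc: "mpow A (Suc n) = A ** mpow A n"
  by (simp_all add: mpow_def)

lemma mpow_Suc2: "mpow A (Suc n) = mpow A n ** A"
  by (induction n) (simp_all add: mpow_0 mpow_Suc matrix_mul_assoc)

lemma mpow_scaleR: "mpow (t *\<^sub>R A) n = t ^ n *\<^sub>R mpow A n"
  by (induction n)
     (simp_all add: mpow_0 mpow_Suc vec_eq_iff matrix_matrix_mult_def sum_distrib_left mult_ac)

text \<open>The entrywise l1 norm. It dominates every row sum, so the entries of powers grow at most
  geometrically, which is all that the convergence of the series needs.\<close>

definition entry_sum :: "real^'s^'s \<Rightarrow> real" where
  "entry_sum A = (\<Sum>i\<in>UNIV. \<Sum>j\<in>UNIV. \<bar>A $ i $ j\<bar>)"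

lemma norm_le_entry_sum: "norm A \<le> entry_sum A"
  unfolding entry_sum_def norm_vec_def [of A]
  by (rule order_trans[OF L2_set_le_sum]) (auto intro!: sum_mono norm_le_l1_cart)

lemma abs_mpow_entry_le: "\<bar>mpow A n $ i $ j\<bar> \<le> entry_sum A ^ n"
proof (induction n arbitrary: i j)
  case 0
  then show ?case by (simp add: mpow_0 mat_def)
next
  case (Suc n)
  have "\<bar>mpow A (Suc n) $ i $ j\<bar> \<le> (\<Sum>k\<in>UNIV. \<bar>A $ i $ k * mpow A n $ k $ j\<bar>)"
    by (simp add: mpow_Suc matrix_matrix_mult_def)
  also have "\<dots> \<le> (\<Sum>k\<in>UNIV. \<bar>A $ i $ k\<bar> * entry_sum A ^ n)"
    by (intro sum_mono) (auto simp: abs_mult intro!: mult_left_mono Suc.IH)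
  also have "\<dots> = (\<Sum>k\<in>UNIV. \<bar>A $ i $ k\<bar>) * entry_sum A ^ n"
    by (simp add: sum_distrib_right)
  also have "\<dots> \<le> entry_sum A * entry_sum A ^ n"
    unfolding entry_sum_def
    by (intro mult_right_mono zero_le_power sum_nonneg
          member_le_sum[where f = "\<lambda>i. \<Sum>k\<in>UNIV. \<bar>A $ i $ k\<bar>"]) auto
  finally show ?case by simp
qed

lemma summable_matrix_exp:
  fixes A :: "real^'s^'s"
  shows "summable (\<lambda>n. (1 / fact n) *\<^sub>R mpow A n)"
proof (rule summable_comparison_test')
  show "summable (\<lambda>n. (real CARD('s) * real CARD('s)) * (inverse (fact n) * entry_sum A ^ n))"
    by (intro summable_mult summable_exp)
  fix n
  have "norm (mpow A n) \<le> entry_sum (mpow A n)" by (rule norm_le_entry_sum)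
  also have "\<dots> \<le> (\<Sum>i\<in>(UNIV::'s set). \<Sum>j\<in>(UNIV::'s set). entry_sum A ^ n)"
    unfolding entry_sum_def[of "mpow A n"] by (intro sum_mono abs_mpow_entry_le)
  also have "\<dots> = (real CARD('s) * real CARD('s)) * entry_sum A ^ n" by simp
  finally show "norm ((1 / fact n) *\<^sub>R mpow A n) \<le>
      (real CARD('s) * real CARD('s)) * (inverse (fact n) * entry_sum A ^ n)"
    by (simp add: field_simps)
qed

text \<open>Each entry of exp(tA) is a scalar power series in t, so termwise differentiation of real
  power series applies and no Banach algebra of matrices is required.\<close>

lemma matrix_exp_entry_sums:
  fixes A :: "real^'s^'s"
  shows "(\<lambda>n. mpow A n $ i $ j / fact n * t ^ n) sums matrix_exp (t *\<^sub>R A) $ i $ j"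
proof -
  have "bounded_linear (\<lambda>B :: real^'s^'s. B $ i $ j)"
    by (intro bounded_linear_compose[OF bounded_linear_vec_nth] bounded_linear_vec_nth)
  then have "(\<lambda>n. ((1 / fact n) *\<^sub>R mpow (t *\<^sub>R A) n) $ i $ j) sums matrix_exp (t *\<^sub>R A) $ i $ j"
    unfolding matrix_exp_def mpow_def[symmetric]
    by (rule bounded_linear.sums[OF _ summable_sums[OF summable_matrix_exp]])
  then show ?thesis by (simp add: mpow_scaleR mult_ac)
qed

lemma matrix_exp_0: "matrix_exp 0 = (mat 1 :: real^'s^'s)"
proof -
  have "matrix_exp 0 $ i $ j = (mat 1 :: real^'s^'s) $ i $ j" for i j
  proof -
    have "(\<lambda>n. mpow (0 :: real^'s^'s) n $ i $ j / fact n * 0 ^ n) sums (mpow 0 0 $ i $ j / fact 0)"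
      by (rule powser_sums_zero)
    then show ?thesis
      using matrix_exp_entry_sums[of "0 :: real^'s^'s" i j 0] sums_unique2
      by (fastforce simp: mpow_0)
  qed
  then show ?thesis by (simp add: vec_eq_iff)
qed

text \<open>The factor A stands on the right so that exp(tQ) v has derivative exp(tQ) (Q v), the
  form into which the Poisson equation can be substituted.\<close>

lemma has_field_derivative_matrix_exp_entry:
  "((\<lambda>t. matrix_exp (t *\<^sub>R A) $ i $ j) has_field_derivative (matrix_exp (t *\<^sub>R A) ** A) $ i $ j) (at t)"
proof -
  define a where "a n = mpow A n $ i $ j / fact n" for n
  have a: "(\<Sum>n. a n * x ^ n) = matrix_exp (x *\<^sub>R A) $ i $ j" for x
    using matrix_exp_entry_sums[of A i j x] by (simp add: a_def sums_iff)
  have "summable (\<lambda>n. a n * x ^ n)" for x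
    using matrix_exp_entry_sums[of A i j x] by (simp add: a_def sums_iff)
  then have "((\<lambda>x. \<Sum>n. a n * x ^ n) has_field_derivative (\<Sum>n. diffs a n * t ^ n)) (at t)"
    by (rule termdiffs_strong_converges_everywhere)
  moreover have "(\<lambda>n. diffs a n * t ^ n) sums (matrix_exp (t *\<^sub>R A) ** A) $ i $ j"
  proof -
    have "(\<lambda>n. \<Sum>k\<in>UNIV. mpow A n $ i $ k / fact n * t ^ n * A $ k $ j) sums
        (\<Sum>k\<in>UNIV. matrix_exp (t *\<^sub>R A) $ i $ k * A $ k $ j)"
      by (intro sums_sum sums_mult2 matrix_exp_entry_sums)
    moreover have "(\<Sum>k\<in>UNIV. mpow A n $ i $ k / fact n * t ^ n * A $ k $ j) = diffs a n * t ^ n" for n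
    proof -
      have "diffs a n = mpow A (Suc n) $ i $ j / fact n"
        unfolding diffs_def a_def by (simp del: of_nat_Suc)
      then show ?thesis
        by (simp add: mpow_Suc2 matrix_matrix_mult_def sum_distrib_left sum_distrib_right sum_divide_distrib mult_ac)
    qed
    ultimately show ?thesis by (simp add: matrix_matrix_mult_def)
  qed
  ultimately show ?thesis by (simp add: a sums_iff)
qed

lemma has_field_derivative_matrix_exp_mult:
  "((\<lambda>t. (matrix_exp (t *\<^sub>R A) *v v) $ i) has_field_derivative
     (matrix_exp (t *\<^sub>R A) *v (A *v v)) $ i) (at t)"
proof -
  have "((\<lambda>t. \<Sum>j\<in>UNIV. matrix_exp (t *\<^sub>R A) $ i $ j * v $ j) has_field_derivative
     (\<Sum>j\<in>UNIV. (matrix_exp (t *\<^sub>R A) ** A) $ i $ j * v $ j)) (at t)"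
    by (intro DERIV_sum DERIV_cmult_right has_field_derivative_matrix_exp_entry)
  then show ?thesis
    unfolding matrix_vector_mul_assoc by (simp add: matrix_vector_mult_def)
qed

text \<open>The diagonal entry starts at 1 with slope \<open>A $ k $ k\<close>, and
  \<open>- K\<close> is chosen strictly below that slope. A linear bound is what survives being
  raised to a power proportional to the inverse mesh.\<close>

lemma matrix_exp_diag_ge:
  "\<exists>K>0. \<forall>\<^sub>F t in at_right 0. matrix_exp (t *\<^sub>R A) $ k $ k \<ge> 1 - K * t"
proof (intro exI conjI)
  let ?K = "\<bar>A $ k $ k\<bar> + 1"
  show "?K > 0" by simp
  have "((\<lambda>t. matrix_exp (t *\<^sub>R A) $ k $ k) has_field_derivative A $ k $ k) (at 0)"
    using has_field_derivative_matrix_exp_entry[of A k k 0] by (simp add: matrix_exp_0)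
  then have "((\<lambda>t. (matrix_exp (t *\<^sub>R A) $ k $ k - 1) / t) \<longlongrightarrow> A $ k $ k) (at 0)"
    by (simp add: has_field_derivative_iff matrix_exp_0 mat_def)
  then have "\<forall>\<^sub>F t in at 0. (matrix_exp (t *\<^sub>R A) $ k $ k - 1) / t > - ?K"
    by (rule order_tendstoD) linarith
  then have "\<forall>\<^sub>F t in at_right 0. (matrix_exp (t *\<^sub>R A) $ k $ k - 1) / t > - ?K"
    by (auto simp: eventually_at_split)
  moreover have "\<forall>\<^sub>F t in at_right 0. (t::real) > 0" by (simp add: eventually_at_right_less)
  ultimately show "\<forall>\<^sub>F t in at_right 0. matrix_exp (t *\<^sub>R A) $ k $ k \<ge> 1 - ?K * t"
  proof eventually_elim
    case (elim t)
    then show ?case by (simp add: field_simps)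
  qed
qed

text \<open>First-order expansion at 0: a diagonal entry starts at 1, an off-diagonal one at 0 with
  positive slope \<open>A $ i $ j\<close>.\<close>

lemma matrix_exp_entry_pos:
  assumes "i = j \<or> A $ i $ j > 0"
  shows "\<forall>\<^sub>F t in at_right 0. matrix_exp (t *\<^sub>R A) $ i $ j > 0"
proof (cases "i = j")
  case True
  have "((\<lambda>t. matrix_exp (t *\<^sub>R A) $ i $ i) \<longlongrightarrow> matrix_exp (0 *\<^sub>R A) $ i $ i) (at_right 0)"
    using has_field_derivative_matrix_exp_entry[of A i i 0]
    by (meson DERIV_isCont continuous_within tendsto_within_subset subset_UNIV)
  then show ?thesis using True
    by (intro order_tendstoD(1)) (auto simp: matrix_exp_0 mat_def)
next
  case False
  have "((\<lambda>t. matrix_exp (t *\<^sub>R A) $ i $ j) has_field_derivative A $ i $ j) (at 0)"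
    using has_field_derivative_matrix_exp_entry[of A i j 0] by (simp add: matrix_exp_0)
  then have "((\<lambda>t. matrix_exp (t *\<^sub>R A) $ i $ j / t) \<longlongrightarrow> A $ i $ j) (at 0)"
    using False by (simp add: has_field_derivative_iff matrix_exp_0 mat_def)
  then have "\<forall>\<^sub>F t in at 0. matrix_exp (t *\<^sub>R A) $ i $ j / t > 0"
    by (rule order_tendstoD) (use assms False in auto)
  then have "\<forall>\<^sub>F t in at_right 0. matrix_exp (t *\<^sub>R A) $ i $ j / t > 0"
    by (auto simp: eventually_at_split)
  moreover have "\<forall>\<^sub>F t in at_right 0. (t::real) > 0" by (simp add: eventually_at_right_less)
  ultimately show ?thesis
    by eventually_elim (simp add: zero_less_divide_iff)
qed

subsection \<open>Paths with right-constant phase\<close>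

text \<open>The first point strictly after x of the grid of mesh 1 / m. Floor plus one, rather than
  the ceiling, keeps it different from x even when x lies on the grid, as convergence along
  \<open>at_right x\<close> demands.\<close>

lemma filterlim_grid_at_right:
  fixes x :: real
  assumes m: "filterlim m at_top F"
  shows "filterlim (\<lambda>n. (of_int \<lfloor>x * m n\<rfloor> + 1) / m n) (at_right x) F"
proof -
  have pos: "\<forall>\<^sub>F n in F. m n > 0"
    using m by (simp add: filterlim_at_top_dense)
  have gt: "\<forall>\<^sub>F n in F. x < (of_int \<lfloor>x * m n\<rfloor> + 1) / m n"
    using pos by eventually_elim (simp add: field_simps, linarith)
  have le: "\<forall>\<^sub>F n in F. (of_int \<lfloor>x * m n\<rfloor> + 1) / m n \<le> x + inverse (m n)"
    using pos
  proof eventually_elim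
    case (elim n)
    have "(of_int \<lfloor>x * m n\<rfloor> + 1) / m n \<le> (x * m n + 1) / m n"
      using elim by (intro divide_right_mono) auto
    then show ?case using elim by (simp add: field_simps)
  qed
  have "((\<lambda>n. x + inverse (m n)) \<longlongrightarrow> x + 0) F"
    by (intro tendsto_intros tendsto_inverse_0_at_top m)
  then have "((\<lambda>n. (of_int \<lfloor>x * m n\<rfloor> + 1) / m n) \<longlongrightarrow> x) F"
    by (intro tendsto_sandwich[OF _ le tendsto_const])
       (use gt in \<open>auto elim: eventually_mono\<close>)
  then show ?thesis
    using gt by (simp add: filterlim_at eventually_mono)
qed

lemma filterlim_real_Suc_at_top: "filterlim (\<lambda>n. real (Suc n)) at_top sequentially"
  by (rule filterlim_compose[OF filterlim_real_sequentially filterlim_Suc])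

lemma measurable_count_space_finite_iff:
  fixes f :: "'w \<Rightarrow> 's :: finite"
  shows "f \<in> M \<rightarrow>\<^sub>M count_space UNIV \<longleftrightarrow> (\<forall>k. {\<omega> \<in> space M. f \<omega> = k} \<in> sets M)"
proof -
  have "f -` {k} \<inter> space M = {\<omega> \<in> space M. f \<omega> = k}" for k by auto
  then show ?thesis by (simp add: measurable_count_space_eq2)
qed

text \<open>M is an arbitrary measure here, so that the same facts can be instantiated on the
  product with Lebesgue measure and on the sigma-algebra of the past.\<close>

locale right_constant_process =
  fixes M :: "'w measure" and \<phi> :: "real \<Rightarrow> 'w \<Rightarrow> 's :: finite"
  assumes measurable_phase: "0 \<le> t \<Longrightarrow> \<phi> t \<in> M \<rightarrow>\<^sub>M count_space UNIV"
    and right_constant: "\<omega> \<in> space M \<Longrightarrow> 0 \<le> t \<Longrightarrow> \<forall>\<^sub>F s in at_right t. \<phi> s \<omega> = \<phi> t \<omega>"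
begin

lemma eventually_phase_grid:
  assumes "\<omega> \<in> space M" "0 \<le> x" "filterlim m at_top F"
  shows "\<forall>\<^sub>F n in F. \<phi> ((of_int \<lfloor>x * m n\<rfloor> + 1) / m n) \<omega> = \<phi> x \<omega>"
  using right_constant[OF assms(1,2)] filterlim_grid_at_right[OF assms(3), of x]
  unfolding filterlim_iff by blast

lemma phase_sets: "0 \<le> t \<Longrightarrow> {\<omega> \<in> space M. \<phi> t \<omega> = k} \<in> sets M"
  using measurable_phase by (simp add: measurable_count_space_finite_iff)

text \<open>Rounded up to a grid, T takes countably many values, so the phase at the rounded time is
  measurable. By right constancy it agrees with the phase at T from some mesh on, and an eventual
  statement along a sequence is a countable combination of events.\<close>

lemma measurable_time_change:
  assumes T: "T \<in> borel_measurable M" and T0: "\<And>\<omega>. \<omega> \<in> space M \<Longrightarrow> 0 \<le> T \<omega>"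
  shows "(\<lambda>\<omega>. \<phi> (T \<omega>) \<omega>) \<in> M \<rightarrow>\<^sub>M count_space UNIV"
proof -
  define g where "g n \<omega> = \<phi> ((of_int \<lfloor>T \<omega> * real (Suc n)\<rfloor> + 1) / real (Suc n)) \<omega>" for n \<omega>
  have g: "g n \<in> M \<rightarrow>\<^sub>M count_space UNIV" for n
  proof -
    have "(\<lambda>\<omega>. \<phi> ((real (nat \<lfloor>T \<omega> * real (Suc n)\<rfloor>) + 1) / real (Suc n)) \<omega>) \<in> M \<rightarrow>\<^sub>M count_space UNIV"
    proof (rule measurable_compose_countable[where f = "\<lambda>k. \<phi> ((real k + 1) / real (Suc n))"])
      show "\<phi> ((real k + 1) / real (Suc n)) \<in> M \<rightarrow>\<^sub>M count_space UNIV" for k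
        by (rule measurable_phase) simp
      show "(\<lambda>\<omega>. nat \<lfloor>T \<omega> * real (Suc n)\<rfloor>) \<in> M \<rightarrow>\<^sub>M count_space UNIV"
        using T by measurable
    qed
    moreover have "g n \<omega> = \<phi> ((real (nat \<lfloor>T \<omega> * real (Suc n)\<rfloor>) + 1) / real (Suc n)) \<omega>"
      if "\<omega> \<in> space M" for \<omega>
    proof -
      have "0 \<le> \<lfloor>T \<omega> * real (Suc n)\<rfloor>" using T0[OF that] by simp
      then show ?thesis by (simp add: g_def of_nat_nat)
    qed
    ultimately show ?thesis by (rule measurable_cong[THEN iffD2, rotated])
  qed
  have "{\<omega> \<in> space M. \<phi> (T \<omega>) \<omega> = k} \<in> sets M" for k
  proof -
    have "(\<phi> (T \<omega>) \<omega> = k) \<longleftrightarrow> (\<forall>\<^sub>F n in sequentially. g n \<omega> = k)" if "\<omega> \<in> space M" for \<omega>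
    proof -
      have ev: "\<forall>\<^sub>F n in sequentially. g n \<omega> = \<phi> (T \<omega>) \<omega>"
        unfolding g_def using that T0[OF that] by (intro eventually_phase_grid filterlim_real_Suc_at_top)
      show ?thesis
      proof
        assume "\<phi> (T \<omega>) \<omega> = k" then show "\<forall>\<^sub>F n in sequentially. g n \<omega> = k" using ev by simp
      next
        assume "\<forall>\<^sub>F n in sequentially. g n \<omega> = k"
        with ev have "\<forall>\<^sub>F n in sequentially. \<phi> (T \<omega>) \<omega> = k" by eventually_elim simp
        then show "\<phi> (T \<omega>) \<omega> = k" by simp
      qed
    qed
    then have "{\<omega> \<in> space M. \<phi> (T \<omega>) \<omega> = k} = {\<omega> \<in> space M. \<forall>\<^sub>F n in sequentially. g n \<omega> = k}"
      by (intro Collect_cong conj_cong refl)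
    moreover have "{\<omega> \<in> space M. g n \<omega> = k} \<in> sets M" for n
      using g by (simp add: measurable_count_space_finite_iff)
    ultimately show ?thesis by (simp only: sets_Collect_eventually_sequentially)
  qed
  then show ?thesis
    unfolding measurable_count_space_finite_iff by blast
qed

text \<open>Joint measurability is a time change on the product space, by the first coordinate.\<close>

lemma measurable_phase_joint:
  "(\<lambda>(s, \<omega>). \<phi> (max 0 s) \<omega>) \<in> (lborel :: real measure) \<Otimes>\<^sub>M M \<rightarrow>\<^sub>M count_space UNIV"
proof -
  interpret J: right_constant_process "(lborel :: real measure) \<Otimes>\<^sub>M M" "\<lambda>t p. \<phi> t (snd p)"
  proof
    fix t :: real assume "0 \<le> t"
    then show "(\<lambda>p. \<phi> t (snd p)) \<in> (lborel :: real measure) \<Otimes>\<^sub>M M \<rightarrow>\<^sub>M count_space UNIV"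
      using measurable_phase by measurable
  qed (auto simp: space_pair_measure right_constant)
  have "(\<lambda>p. \<phi> (max 0 (fst p)) (snd p)) \<in> (lborel :: real measure) \<Otimes>\<^sub>M M \<rightarrow>\<^sub>M count_space UNIV"
    by (rule J.measurable_time_change) auto
  then show ?thesis by (simp add: case_prod_beta')
qed

section \<open>The level along a path\<close>

definition level :: "real^'s \<Rightarrow> real \<Rightarrow> 'w \<Rightarrow> real" where
  "level c t \<omega> = (LBINT s:{0..t}. c $ \<phi> s \<omega>)"

text \<open>Nothing is known about the phase at negative times. \<open>max 0 s\<close> replaces them
  by 0, which the indicator hides, and makes the integrand jointly measurable on the whole
  line.\<close>

lemma level_eq: "level c t \<omega> = (LINT s|lborel. indicator {0..t} s * c $ \<phi> (max 0 s) \<omega>)"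
  unfolding level_def set_lebesgue_integral_def
  by (intro Bochner_Integration.integral_cong) (auto simp: indicator_def)

lemma measurable_rate_joint:
  "(\<lambda>(s, \<omega>). indicator {0..t} s * (c :: real^'s) $ \<phi> (max 0 s) \<omega>) \<in> borel_measurable (lborel \<Otimes>\<^sub>M M)"
proof -
  have "(\<lambda>p. c $ (case p of (s, \<omega>) \<Rightarrow> \<phi> (max 0 s) \<omega>)) \<in> borel_measurable (lborel \<Otimes>\<^sub>M M)"
    by (rule measurable_compose[OF measurable_phase_joint]) simp
  then have [measurable]: "(\<lambda>p. c $ \<phi> (max 0 (fst p)) (snd p)) \<in> borel_measurable (lborel \<Otimes>\<^sub>M M)"
    by (simp add: case_prod_beta')
  show ?thesis unfolding case_prod_beta' by measurable
qed

lemma measurable_level: "level c t \<in> borel_measurable M"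
proof -
  have "case_prod (\<lambda>\<omega> s. indicator {0..t} s * c $ \<phi> (max 0 s) \<omega>) \<in> borel_measurable (M \<Otimes>\<^sub>M lborel)"
    using measurable_pair_swap[OF measurable_rate_joint[of t c]] by (simp add: case_prod_beta')
  then have "(\<lambda>\<omega>. LINT s|lborel. indicator {0..t} s * c $ \<phi> (max 0 s) \<omega>) \<in> borel_measurable M"
    by (rule lborel.borel_measurable_lebesgue_integral)
  moreover have "level c t = (\<lambda>\<omega>. LINT s|lborel. indicator {0..t} s * c $ \<phi> (max 0 s) \<omega>)"
    by (rule ext) (rule level_eq)
  ultimately show ?thesis by simp
qed

lemma set_integrable_rate:
  fixes c :: "real^'s"
  assumes "\<omega> \<in> space M" "0 \<le> a"
  shows "set_integrable lborel {a..b} (\<lambda>s. c $ \<phi> s \<omega>)"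
proof -
  have "(\<lambda>s. c $ \<phi> (max 0 s) \<omega>) \<in> borel_measurable lborel"
    using measurable_compose[OF measurable_Pair2'[OF assms(1)] measurable_phase_joint, unfolded split]
    by (rule measurable_compose[where g = "\<lambda>i. c $ i" and N = "count_space UNIV"]) simp
  then have "set_integrable lborel {a..b} (\<lambda>s. c $ \<phi> (max 0 s) \<omega>)"
    unfolding set_integrable_def
    by (intro integrableI_bounded_set_indicator[where B = "norm c"])
       (auto simp: component_le_norm_cart emeasure_lborel_Icc_eq)
  then show ?thesis
    by (rule set_integrable_cong[THEN iffD1, rotated -1]) (use assms in auto)
qed

lemma level_0: "level c 0 \<omega> = 0"
  proof -
  have "AE s in lborel. indicator {0..0} s *\<^sub>R c $ \<phi> s \<omega> = 0"
    by (rule AE_mp[OF AE_lborel_singleton[of 0]]) (auto simp: indicator_def)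
  then show ?thesis
    unfolding level_def set_lebesgue_integral_def by (rule integral_eq_zero_AE)
qed

lemma level_diff:
  assumes "\<omega> \<in> space M" "0 \<le> t" "t \<le> u"
  shows "level c u \<omega> = level c t \<omega> + (LBINT s:{t..u}. c $ \<phi> s \<omega>)"
proof -
  have "level c u \<omega> = (LBINT s:{0..t} \<union> {t..u}. c $ \<phi> s \<omega>)"
    using assms by (simp add: level_def ivl_disj_un)
  also have "\<dots> = level c t \<omega> + (LBINT s:{t..u}. c $ \<phi> s \<omega>)"
    unfolding level_def
  proof (rule set_integral_Un_AE)
    show "AE s in lborel. \<not> (s \<in> {0..t} \<and> s \<in> {t..u})"
      by (rule AE_mp[OF AE_lborel_singleton[of t]]) auto
  qed (use assms in \<open>auto intro: set_integrable_rate\<close>)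
  finally show ?thesis .
qed

lemma level_Lipschitz:
  assumes "\<omega> \<in> space M" "0 \<le> t" "t \<le> u"
  shows "\<bar>level c u \<omega> - level c t \<omega>\<bar> \<le> norm c * (u - t)"
proof -
  have "\<bar>LBINT s:{t..u}. c $ \<phi> s \<omega>\<bar> \<le> (LBINT s:{t..u}. norm c)"
  proof -
    have "norm (LBINT s:{t..u}. c $ \<phi> s \<omega>) \<le> (LBINT s:{t..u}. norm (c $ \<phi> s \<omega>))"
      using assms by (intro set_integral_norm_bound set_integrable_rate)
    also have "\<dots> \<le> (LBINT s:{t..u}. norm c)"
      using assms
      by (intro set_integral_mono set_integrable_norm set_integrable_rate)
         (auto simp: component_le_norm_cart set_integrable_def emeasure_lborel_Icc_eq)
    finally show ?thesis by simp
  qed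
  then show ?thesis using assms level_diff[OF assms, of c]
    by (simp add: set_integral_const measure_lborel_Icc emeasure_lborel_Icc_eq mult.commute)
qed

text \<open>The phase is fixed only before u: a path holding k on a half-open interval may jump at
  its end, and that single instant has measure zero.\<close>

lemma level_const_phase:
  assumes "\<omega> \<in> space M" "0 \<le> t" "t \<le> u" "\<And>s. t \<le> s \<Longrightarrow> s < u \<Longrightarrow> \<phi> s \<omega> = k"
  shows "level c u \<omega> = level c t \<omega> + c $ k * (u - t)"
proof -
  have "(LBINT s:{t..u}. c $ \<phi> s \<omega>) = (LBINT s:{t..u}. c $ k)"
    unfolding set_lebesgue_integral_def
  proof (rule integral_cong_AE)
    show "AE s in lborel. indicator {t..u} s *\<^sub>R c $ \<phi> s \<omega> = indicator {t..u} s *\<^sub>R c $ k"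
      by (rule AE_mp[OF AE_lborel_singleton[of u]]) (auto simp: assms(4) indicator_def)
    show "(\<lambda>s. indicator {t..u} s *\<^sub>R c $ \<phi> s \<omega>) \<in> borel_measurable lborel"
      using set_integrable_rate[OF assms(1,2), of u c]
      unfolding set_integrable_def by (rule borel_measurable_integrable)
  qed simp
  then show ?thesis using assms(3) level_diff[OF assms(1-3), of c]
    by (simp add: set_integral_const emeasure_lborel_Icc_eq mult.commute)
qed

text \<open>Linearity holds to the right of t only, which suffices because the direction of an exit
  is decided just after the exit time.\<close>

lemma level_locally_linear:
  assumes "\<omega> \<in> space M" "0 \<le> t"
  shows "\<exists>e>0. \<forall>u\<in>{t..t+e}. level c u \<omega> = level c t \<omega> + c $ \<phi> t \<omega> * (u - t)"
proof -
  obtain d where d: "d > t" "\<And>s. t < s \<Longrightarrow> s < d \<Longrightarrow> \<phi> s \<omega> = \<phi> t \<omega>"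
    using right_constant[OF assms] unfolding eventually_at_right_field by auto
  show ?thesis
  proof (intro exI[of _ "d - t"] conjI ballI)
    fix u assume u: "u \<in> {t..t + (d - t)}"
    show "level c u \<omega> = level c t \<omega> + c $ \<phi> t \<omega> * (u - t)"
    proof (rule level_const_phase[OF assms])
      fix s assume "t \<le> s" "s < u"
      then show "\<phi> s \<omega> = \<phi> t \<omega>" using d(2)[of s] u by (cases "s = t") auto
    qed (use u in auto)
  qed (use d in auto)
qed

lemma continuous_on_level: "\<omega> \<in> space M \<Longrightarrow> continuous_on {0..} (\<lambda>t. level c t \<omega>)"
proof (rule lipschitz_on_continuous_on)
  assume "\<omega> \<in> space M"
  then show "(norm c)-lipschitz_on {0..} (\<lambda>t. level c t \<omega>)"
  proof (intro lipschitz_onI)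
    fix x y :: real assume "x \<in> {0..}" "y \<in> {0..}"
    then show "dist (level c x \<omega>) (level c y \<omega>) \<le> norm c * dist x y"
      using level_Lipschitz[OF \<open>\<omega> \<in> space M\<close>, of x y c] level_Lipschitz[OF \<open>\<omega> \<in> space M\<close>, of y x c]
      by (cases "x \<le> y") (auto simp: dist_real_def abs_minus_commute)
  qed simp
qed

section \<open>The natural filtration\<close>

text \<open>The sigma-algebra of \<open>history\<close>, packaged as a measure so that measurability
  of functions with respect to it can be expressed.\<close>

definition past :: "real \<Rightarrow> 'w measure" where
  "past t = sigma (space M) {{\<omega> \<in> space M. \<phi> u \<omega> = k} | u k. 0 \<le> u \<and> u \<le> t}"

lemma space_past [simp]: "space (past t) = space M"
  unfolding past_def by (rule space_measure_of) auto

lemma sets_past: "sets (past t) = history M \<phi> t"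
  unfolding past_def history_def by (rule sets_measure_of) auto

lemma past_mono: "t \<le> u \<Longrightarrow> sets (past t) \<subseteq> sets (past u)"
  unfolding sets_past history_def by (rule sigma_sets_mono') (use order_trans in blast)

lemma past_subset: "sets (past t) \<subseteq> sets M"
  unfolding sets_past history_def by (intro sets.sigma_sets_subset) (auto intro: phase_sets)

lemma phase_past: "0 \<le> u \<Longrightarrow> u \<le> t \<Longrightarrow> {\<omega> \<in> space M. \<phi> u \<omega> = k} \<in> sets (past t)"
  unfolding sets_past history_def by (rule sigma_sets.Basic) blast

text \<open>
  The process stopped at \<open>u\<close> is again right constant and is measurable for the past, so that the
  general measurability of the level applies to it.
\<close>

lemma measurable_level_past:
  assumes "0 \<le> u" "u \<le> t"
  shows "level c u \<in> borel_measurable (past t)"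
proof -
  interpret P: right_constant_process "past t" "\<lambda>s. \<phi> (min s u)"
  proof
    fix s :: real assume s: "0 \<le> s"
    have "{\<omega> \<in> space M. \<phi> (min s u) \<omega> = k} \<in> sets (past t)" for k
      by (rule phase_past) (use assms s in auto)
    then show "\<phi> (min s u) \<in> past t \<rightarrow>\<^sub>M count_space UNIV"
      by (simp add: measurable_count_space_finite_iff)
  next
    fix \<omega> s assume "\<omega> \<in> space (past t)" and s: "(0::real) \<le> s"
    then have \<omega>: "\<omega> \<in> space M" by simp
    show "\<forall>\<^sub>F r in at_right s. \<phi> (min r u) \<omega> = \<phi> (min s u) \<omega>"
    proof (cases "s < u")
      case True
      have "\<forall>\<^sub>F r in at_right s. r < u"
        using True by (intro eventually_at_rightI[of s u]) auto
      with right_constant[OF \<omega> s] show ?thesis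
        by eventually_elim (use True in \<open>simp add: min_def\<close>)
    next
      case False
      have "\<forall>\<^sub>F r in at_right s. s < r" by (simp add: eventually_at_right_less)
      then show ?thesis by eventually_elim (use False in \<open>simp add: min_def\<close>)
    qed
  qed
  have "P.level c u = level c u"
    by (auto simp: P.level_def level_def fun_eq_iff set_lebesgue_integral_def
        intro!: Bochner_Integration.integral_cong split: split_indicator)
  then show ?thesis using P.measurable_level[of c u] by simp
qed

end

subsection \<open>The martingale\<close>

locale markov_process = prob_space M + right_constant_process M \<phi>
  for M :: "'w measure" and \<phi> :: "real \<Rightarrow> 'w \<Rightarrow> 's :: finite" +
  fixes Q :: "real^'s^'s"
  assumes markov: "0 \<le> s \<Longrightarrow> 0 \<le> t \<Longrightarrow> E \<in> sets (past s) \<Longrightarrow>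
    prob {\<omega> \<in> E. \<phi> s \<omega> = i \<and> \<phi> (s + t) \<omega> = j} =
    prob {\<omega> \<in> E. \<phi> s \<omega> = i} * matrix_exp (t *\<^sub>R Q) $ i $ j"
begin

lemma past_sets: "E \<in> sets (past s) \<Longrightarrow> E \<in> sets M"
  using past_subset by blast

lemma sets_phase_cond: "E \<in> sets M \<Longrightarrow> 0 \<le> t \<Longrightarrow> {\<omega> \<in> E. \<phi> t \<omega> = i} \<in> sets M"
proof -
  assume E: "E \<in> sets M" and t: "0 \<le> t"
  have "{\<omega> \<in> E. \<phi> t \<omega> = i} = E \<inter> {\<omega> \<in> space M. \<phi> t \<omega> = i}"
    using sets.sets_into_space[OF E] by auto
  then show ?thesis using E phase_sets[OF t] by simp
qed

text \<open>The Markov property passes from events to functions of the phase because such a function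
  is a finite combination of indicators of the pairs (phase at s, phase at s + t).\<close>

lemma integral_phase:
  assumes s: "0 \<le> s" and t: "0 \<le> t" and E: "E \<in> sets (past s)"
  shows "(LINT \<omega>|M. indicator E \<omega> * v $ \<phi> (s + t) \<omega>) =
    (\<Sum>i\<in>UNIV. prob {\<omega> \<in> E. \<phi> s \<omega> = i} * (matrix_exp (t *\<^sub>R Q) *v v) $ i)"
proof -
  define D where "D i j = {\<omega> \<in> E. \<phi> s \<omega> = i \<and> \<phi> (s + t) \<omega> = j}" for i j
  have "D i j = {\<omega> \<in> {\<omega> \<in> E. \<phi> s \<omega> = i}. \<phi> (s + t) \<omega> = j}" for i j
    by (auto simp: D_def)
  then have D: "D i j \<in> sets M" for i j
    using s t past_sets[OF E] by (simp only: sets_phase_cond add_nonneg_nonneg)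
  have "indicator E \<omega> * v $ \<phi> (s + t) \<omega> = (\<Sum>i\<in>UNIV. \<Sum>j\<in>UNIV. v $ j * indicator (D i j) \<omega>)" for \<omega>
  proof -
    have "v $ j * indicator (D i j) \<omega> =
      (if j = \<phi> (s + t) \<omega> then if i = \<phi> s \<omega> then indicator E \<omega> * v $ j else 0 else 0)" for i j
      by (auto simp: D_def indicator_def)
    then show ?thesis by simp
  qed
  then have "(LINT \<omega>|M. indicator E \<omega> * v $ \<phi> (s + t) \<omega>) =
      (LINT \<omega>|M. (\<Sum>i\<in>UNIV. \<Sum>j\<in>UNIV. v $ j * indicator (D i j) \<omega>))"
    by simp
  also have "\<dots> = (\<Sum>i\<in>UNIV. \<Sum>j\<in>UNIV. v $ j * prob (D i j))"
  proof -
    have I: "integrable M (\<lambda>\<omega>. v $ j * indicator (D i j) \<omega>)" for i j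
      using D by (simp add: emeasure_eq_measure)
    have "(LINT \<omega>|M. v $ j * indicator (D i j) \<omega>) = v $ j * prob (D i j)" for i j
      using D by simp
    then show ?thesis
      by (simp only: Bochner_Integration.integral_sum Bochner_Integration.integrable_sum I)
  qed
  also have "\<dots> = (\<Sum>i\<in>UNIV. \<Sum>j\<in>UNIV. v $ j * (prob {\<omega> \<in> E. \<phi> s \<omega> = i} * matrix_exp (t *\<^sub>R Q) $ i $ j))"
    using markov[OF s t E] by (simp add: D_def)
  also have "\<dots> = (\<Sum>i\<in>UNIV. prob {\<omega> \<in> E. \<phi> s \<omega> = i} * (matrix_exp (t *\<^sub>R Q) *v v) $ i)"
    by (simp add: matrix_vector_mult_def sum_distrib_left mult_ac)
  finally show ?thesis .
qed

text \<open>Fubini moves the expectation inside the time integral, where the Markov property can be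
  used at each fixed time r.\<close>

lemma integral_level_diff:
  fixes c :: "real^'s"
  assumes s: "0 \<le> s" and t: "0 \<le> t" and E: "E \<in> sets (past s)"
  shows "(LINT \<omega>|M. indicator E \<omega> * (level c (s + t) \<omega> - level c s \<omega>)) =
    (LINT r|lborel. indicator {s..s+t} r * (LINT \<omega>|M. indicator E \<omega> * c $ \<phi> (max 0 r) \<omega>))"
proof -
  interpret P: pair_sigma_finite "lborel :: real measure" M ..
  have [measurable]: "E \<in> sets M" using E by (rule past_sets)
  let ?f = "\<lambda>r \<omega>. indicator {s..s+t} r * (indicator E \<omega> * c $ \<phi> (max 0 r) \<omega>)"
  have "(\<lambda>p. c $ (case p of (r, \<omega>) \<Rightarrow> \<phi> (max 0 r) \<omega>)) \<in> borel_measurable (lborel \<Otimes>\<^sub>M M)"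
    by (rule measurable_compose[OF measurable_phase_joint]) simp
  then have [measurable]: "(\<lambda>p. c $ \<phi> (max 0 (fst p)) (snd p)) \<in> borel_measurable (lborel \<Otimes>\<^sub>M M)"
    by (simp add: case_prod_beta')
  have f: "integrable (lborel \<Otimes>\<^sub>M M) (case_prod ?f)"
  proof (rule integrableI_bounded_set)
    show "{s..s+t} \<times> space M \<in> sets (lborel \<Otimes>\<^sub>M M)" by simp
    show "case_prod ?f \<in> borel_measurable (lborel \<Otimes>\<^sub>M M)"
      unfolding case_prod_beta' by measurable
    show "emeasure (lborel \<Otimes>\<^sub>M M) ({s..s+t} \<times> space M) < \<infinity>"
      using t by (subst emeasure_pair_measure_Times)
         (auto simp: emeasure_space_1)
    show "AE p in lborel \<Otimes>\<^sub>M M. p \<in> {s..s+t} \<times> space M \<longrightarrow> norm (case_prod ?f p) \<le> norm c"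
      by (auto simp: abs_mult indicator_def component_le_norm_cart)
    show "AE p in lborel \<Otimes>\<^sub>M M. p \<notin> {s..s+t} \<times> space M \<longrightarrow> case_prod ?f p = 0"
      by (rule AE_I2) (auto simp: space_pair_measure indicator_eq_0_iff)
  qed
  have "(LINT \<omega>|M. indicator E \<omega> * (level c (s + t) \<omega> - level c s \<omega>)) = (LINT \<omega>|M. LINT r|lborel. ?f r \<omega>)"
  proof (rule Bochner_Integration.integral_cong[OF refl])
    fix \<omega> assume \<omega>: "\<omega> \<in> space M"
    have "level c (s + t) \<omega> - level c s \<omega> = (LBINT r:{s..s+t}. c $ \<phi> r \<omega>)"
      using level_diff[OF \<omega> s, of "s + t" c] t by simp
    also have "\<dots> = (LINT r|lborel. indicator {s..s+t} r * c $ \<phi> (max 0 r) \<omega>)"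
      unfolding set_lebesgue_integral_def
      by (intro Bochner_Integration.integral_cong) (use s in \<open>auto simp: indicator_def\<close>)
    finally show "indicator E \<omega> * (level c (s + t) \<omega> - level c s \<omega>) = (LINT r|lborel. ?f r \<omega>)"
      by (simp add: mult.left_commute[of _ "indicator E \<omega>"])
  qed
  also have "\<dots> = (LINT r|lborel. LINT \<omega>|M. ?f r \<omega>)"
    by (rule P.Fubini_integral[OF f])
  finally show ?thesis by simp
qed

definition drift_martingale :: "real^'s \<Rightarrow> real^'s \<Rightarrow> real \<Rightarrow> 'w \<Rightarrow> real" where
  "drift_martingale c h t \<omega> = level c t \<omega> + h $ \<phi> t \<omega>"

lemma measurable_phase_component: "0 \<le> t \<Longrightarrow> (\<lambda>\<omega>. (v :: real^'s) $ \<phi> t \<omega>) \<in> borel_measurable M"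
  by (rule measurable_compose[OF measurable_phase]) simp_all

lemma abs_level_le: "\<omega> \<in> space M \<Longrightarrow> 0 \<le> t \<Longrightarrow> \<bar>level c t \<omega>\<bar> \<le> norm c * t"
  using level_Lipschitz[of \<omega> 0 t c] by (simp add: level_0)

lemma integrable_drift_martingale:
  assumes "0 \<le> t"
  shows "integrable M (drift_martingale c h t)"
proof (rule integrable_const_bound)
  show "AE \<omega> in M. norm (drift_martingale c h t \<omega>) \<le> norm c * t + norm h"
    unfolding drift_martingale_def real_norm_def
    by (intro AE_I2 order_trans[OF abs_triangle_ineq] add_mono abs_level_le component_le_norm_cart assms)
  show "drift_martingale c h t \<in> borel_measurable M"
    unfolding drift_martingale_def[abs_def]
    using measurable_level measurable_phase_component[OF assms] by (rule borel_measurable_add)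
qed

text \<open>The martingale property, tested on events of the past instead of stated by conditional
  expectations. If F v r denotes the mean of v at the phase at time r on E, then F v has derivative
  F (Q v). With Q h = -c, the time integral of F c is F h s - F h (s + t), which cancels the change
  of the h-term.\<close>

lemma drift_martingale_increment:
  fixes c h :: "real^'s"
  assumes s: "0 \<le> s" and t: "0 \<le> t" and E: "E \<in> sets (past s)" and h: "Q *v h = - c"
  shows "(LINT \<omega>|M. indicator E \<omega> * (drift_martingale c h (s + t) \<omega> - drift_martingale c h s \<omega>)) = 0"
proof -
  define w where "w i = prob {\<omega> \<in> E. \<phi> s \<omega> = i}" for i
  define F where "F v r = (\<Sum>i\<in>UNIV. w i * (matrix_exp ((r - s) *\<^sub>R Q) *v v) $ i)" for v r
  have F: "(LINT \<omega>|M. indicator E \<omega> * v $ \<phi> r \<omega>) = F v r" if "s \<le> r" for v r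
    using integral_phase[OF s _ E, of "r - s" v] that by (simp add: F_def w_def)
  have F': "(F v has_real_derivative F (Q *v v) r) (at r)" for v r
  proof -
    have "((\<lambda>r. (matrix_exp ((r - s) *\<^sub>R Q) *v v) $ i) has_real_derivative
        (matrix_exp ((r - s) *\<^sub>R Q) *v (Q *v v)) $ i) (at r)" for i
    proof -
      have "((\<lambda>r. r - s) has_real_derivative 1) (at r)"
        by (auto intro!: derivative_eq_intros)
      from DERIV_chain2[OF has_field_derivative_matrix_exp_mult this, of Q v i] show ?thesis by simp
    qed
    then show ?thesis
      unfolding F_def[abs_def] by (intro DERIV_sum DERIV_cmult)
  qed
  have Fc: "F (- v) r = - F v r" for v r
    by (simp add: F_def matrix_vector_mult_def sum_negf)
  have "(LINT r|lborel. indicator {s..s+t} r * (LINT \<omega>|M. indicator E \<omega> * c $ \<phi> (max 0 r) \<omega>)) =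
      (LINT r|lborel. F c r * indicator {s..s+t} r)"
  proof (rule Bochner_Integration.integral_cong[OF refl])
    show "indicator {s..s+t} r * (LINT \<omega>|M. indicator E \<omega> * c $ \<phi> (max 0 r) \<omega>) = F c r * indicator {s..s+t} r" for r
      using F[of r c] s by (cases "r \<in> {s..s+t}") simp_all
  qed
  also have "\<dots> = - F h (s + t) - - F h s"
  proof (rule integral_FTC_Icc_real)
    show "s \<le> s + t" using t by simp
    fix r
    show "((\<lambda>r. - F h r) has_real_derivative F c r) (at r)"
      using DERIV_minus[OF F'[of h r]] by (simp add: h Fc)
    show "isCont (F c) r"
      using F' by (rule DERIV_isCont)
  qed
  finally have 1: "(LINT \<omega>|M. indicator E \<omega> * (level c (s + t) \<omega> - level c s \<omega>)) = F h s - F h (s + t)"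
    using integral_level_diff[OF s t E, of c] by simp
  have [measurable]: "E \<in> sets M" using E by (rule past_sets)
  have I: "integrable M (\<lambda>\<omega>. indicator E \<omega> * h $ \<phi> r \<omega>)" if "0 \<le> r" for r
  proof (rule integrable_const_bound)
    show "AE \<omega> in M. norm (indicator E \<omega> * h $ \<phi> r \<omega>) \<le> norm h"
      by (auto simp: abs_mult indicator_def component_le_norm_cart)
    show "(\<lambda>\<omega>. indicator E \<omega> * h $ \<phi> r \<omega>) \<in> borel_measurable M"
      using measurable_phase_component[OF that, of h] by measurable
  qed
  have J: "integrable M (\<lambda>\<omega>. indicator E \<omega> * (level c (s + t) \<omega> - level c s \<omega>))"
  proof (rule integrable_const_bound)
    show "AE \<omega> in M. norm (indicator E \<omega> * (level c (s + t) \<omega> - level c s \<omega>)) \<le> norm c * t"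
      using level_Lipschitz[OF _ s, of _ "s + t" c] t
      by (intro AE_I2) (auto simp: abs_mult indicator_def)
    show "(\<lambda>\<omega>. indicator E \<omega> * (level c (s + t) \<omega> - level c s \<omega>)) \<in> borel_measurable M"
      using measurable_level[of c s] measurable_level[of c "s + t"] by measurable
  qed
  have "(LINT \<omega>|M. indicator E \<omega> * (drift_martingale c h (s + t) \<omega> - drift_martingale c h s \<omega>)) =
    (LINT \<omega>|M. indicator E \<omega> * (level c (s + t) \<omega> - level c s \<omega>) +
       (indicator E \<omega> * h $ \<phi> (s + t) \<omega> - indicator E \<omega> * h $ \<phi> s \<omega>))"
    by (simp add: drift_martingale_def algebra_simps)
  also have "\<dots> = (F h s - F h (s + t)) + (F h (s + t) - F h s)"
    using I[OF s] I[of "s + t"] J s t by (simp add: 1 F)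
  finally show ?thesis by simp
qed

end

subsection \<open>Reaching and holding a phase\<close>

context markov_process
begin

lemma prob_split_phase:
  assumes "A \<in> sets M" "0 \<le> s"
  shows "prob A = (\<Sum>i\<in>UNIV. prob {\<omega> \<in> A. \<phi> s \<omega> = i})"
proof -
  have "prob (\<Union>i\<in>UNIV. {\<omega> \<in> A. \<phi> s \<omega> = i}) = (\<Sum>i\<in>UNIV. prob {\<omega> \<in> A. \<phi> s \<omega> = i})"
    by (rule finite_measure_finite_Union)
       (use assms sets_phase_cond in \<open>auto simp: disjoint_family_on_def\<close>)
  moreover have "(\<Union>i\<in>UNIV. {\<omega> \<in> A. \<phi> s \<omega> = i}) = A" by auto
  ultimately show ?thesis by simp
qed

lemma past_phase_cond:
  assumes E: "E \<in> sets (past s)" and "s \<le> t" "0 \<le> u" "u \<le> t"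
  shows "{\<omega> \<in> E. \<phi> u \<omega> = i} \<in> sets (past t)"
proof -
  have "{\<omega> \<in> E. \<phi> u \<omega> = i} = E \<inter> {\<omega> \<in> space M. \<phi> u \<omega> = i}"
    using sets.sets_into_space[OF E] by auto
  then show ?thesis using E past_mono[OF \<open>s \<le> t\<close>] phase_past[OF assms(3,4)] by auto
qed

text \<open>Every step of length \<delta> along R costs at most a factor \<rho>. The event E is
  carried along the induction, so the bound is uniform over the past.\<close>

lemma prob_path_ge:
  fixes R :: "('s \<times> 's) set"
  assumes \<delta>: "0 \<le> \<delta>" and \<rho>: "0 \<le> \<rho>"
    and R: "\<And>i j. (i, j) \<in> R \<Longrightarrow> \<rho> \<le> matrix_exp (\<delta> *\<^sub>R Q) $ i $ j"
    and s: "0 \<le> s" and E: "E \<in> sets (past s)"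
  shows "(i, k) \<in> R ^^ n \<Longrightarrow>
    \<rho> ^ n * prob {\<omega> \<in> E. \<phi> s \<omega> = i} \<le> prob {\<omega> \<in> E. \<phi> s \<omega> = i \<and> \<phi> (s + n * \<delta>) \<omega> = k}"
proof (induction n arbitrary: k)
  case 0
  then have "{\<omega> \<in> E. \<phi> s \<omega> = i \<and> \<phi> (s + real 0 * \<delta>) \<omega> = k} = {\<omega> \<in> E. \<phi> s \<omega> = i}" by auto
  then show ?case by simp
next
  case (Suc n)
  then obtain j where j: "(i, j) \<in> R ^^ n" "(j, k) \<in> R" by auto
  let ?t = "s + n * \<delta>"
  have t: "0 \<le> ?t" "s \<le> ?t" using s \<delta> by simp_all
  define E' where "E' = {\<omega> \<in> E. \<phi> s \<omega> = i \<and> \<phi> ?t \<omega> = j}"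
  have E'_eq: "E' = {\<omega> \<in> {\<omega> \<in> E. \<phi> s \<omega> = i}. \<phi> ?t \<omega> = j}" by (auto simp: E'_def)
  have E': "E' \<in> sets (past ?t)"
    unfolding E'_eq by (intro past_phase_cond[of _ ?t] past_phase_cond[of _ s]) (use E s t in auto)
  have "\<rho> ^ Suc n * prob {\<omega> \<in> E. \<phi> s \<omega> = i} \<le> prob E' * \<rho>"
    using mult_right_mono[OF Suc.IH[OF j(1)] \<rho>] by (simp add: E'_def mult_ac)
  also have "\<dots> \<le> prob E' * matrix_exp (\<delta> *\<^sub>R Q) $ j $ k"
    by (intro mult_left_mono R j) simp
  also have "\<dots> = prob {\<omega> \<in> E'. \<phi> ?t \<omega> = j} * matrix_exp (\<delta> *\<^sub>R Q) $ j $ k"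
    by (simp add: E'_def)
  also have "\<dots> = prob {\<omega> \<in> E'. \<phi> ?t \<omega> = j \<and> \<phi> (?t + \<delta>) \<omega> = k}"
    by (rule markov[symmetric, OF t(1) \<delta> E'])
  also have "\<dots> \<le> prob {\<omega> \<in> E. \<phi> s \<omega> = i \<and> \<phi> (s + Suc n * \<delta>) \<omega> = k}"
  proof (rule finite_measure_mono)
    show "{\<omega> \<in> E'. \<phi> ?t \<omega> = j \<and> \<phi> (?t + \<delta>) \<omega> = k} \<subseteq> {\<omega> \<in> E. \<phi> s \<omega> = i \<and> \<phi> (s + Suc n * \<delta>) \<omega> = k}"
      by (auto simp: E'_def algebra_simps)
    have "{\<omega> \<in> {\<omega> \<in> E. \<phi> s \<omega> = i}. \<phi> (s + Suc n * \<delta>) \<omega> = k} \<in> sets M"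
      using s \<delta> by (intro sets_phase_cond past_sets[OF E] add_nonneg_nonneg mult_nonneg_nonneg) simp_all
    then show "{\<omega> \<in> E. \<phi> s \<omega> = i \<and> \<phi> (s + Suc n * \<delta>) \<omega> = k} \<in> sets M"
      by (simp only: mem_Collect_eq conj_assoc)
  qed
  finally show ?case .
qed

text \<open>Irreducibility gives each phase its own path length to k, while a single d is wanted for
  all of them. Waiting in place equalises the lengths.\<close>

lemma prob_reach_ge:
  assumes irr: "irreducible_generator Q"
  obtains d p where "0 < d" "0 < p"
    "\<And>s E. 0 \<le> s \<Longrightarrow> E \<in> sets (past s) \<Longrightarrow> p * prob E \<le> prob {\<omega> \<in> E. \<phi> (s + d) \<omega> = k}"
proof -
  \<comment> \<open>The diagonal is included because staying put for a short time also has positive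
    probability; it allows paths to be padded at k.\<close>
  define R where "R = {(i, j). i = j \<or> Q $ i $ j > 0}"
  have Rpos: "\<forall>\<^sub>F t in at_right 0. \<forall>e\<in>R. matrix_exp (t *\<^sub>R Q) $ fst e $ snd e > 0"
  proof (rule eventually_ball_finite)
    show "\<forall>e\<in>R. \<forall>\<^sub>F t in at_right 0. matrix_exp (t *\<^sub>R Q) $ fst e $ snd e > 0"
      by (intro ballI matrix_exp_entry_pos) (auto simp: R_def)
  qed simp
  have "\<forall>\<^sub>F t in at_right 0. (t::real) > 0" by (simp add: eventually_at_right_less)
  with Rpos have "\<forall>\<^sub>F t in at_right 0. t > 0 \<and> (\<forall>e\<in>R. matrix_exp (t *\<^sub>R Q) $ fst e $ snd e > 0)"
    by eventually_elim (rule conjI)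
  then have "\<exists>t. t > 0 \<and> (\<forall>e\<in>R. matrix_exp (t *\<^sub>R Q) $ fst e $ snd e > 0)"
    by (rule eventually_happens'[OF trivial_limit_at_right_real])
  then obtain \<delta> where \<delta>: "\<delta> > 0" "\<And>e. e \<in> R \<Longrightarrow> matrix_exp (\<delta> *\<^sub>R Q) $ fst e $ snd e > 0"
    by blast
  define \<rho> where "\<rho> = Min ((\<lambda>e. matrix_exp (\<delta> *\<^sub>R Q) $ fst e $ snd e) ` R)"
  have ne: "(k, k) \<in> R" by (simp add: R_def)
  have "\<rho> \<in> (\<lambda>e. matrix_exp (\<delta> *\<^sub>R Q) $ fst e $ snd e) ` R"
    unfolding \<rho>_def by (rule Min_in) (use ne in auto)
  then have \<rho>0: "\<rho> > 0" using \<delta>(2) by auto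
  have \<rho>: "\<rho> \<le> matrix_exp (\<delta> *\<^sub>R Q) $ i $ j" if "(i, j) \<in> R" for i j
    unfolding \<rho>_def using imageI[OF that, of "\<lambda>e. matrix_exp (\<delta> *\<^sub>R Q) $ fst e $ snd e"]
    by (intro Min_le) simp_all
  have "\<exists>n. (i, k) \<in> R ^^ n" for i
  proof -
    have "(i, k) \<in> {(k, l). k \<noteq> l \<and> 0 < Q $ k $ l}\<^sup>*"
      using irr by (simp add: irreducible_generator_def)
    then have "(i, k) \<in> R\<^sup>*"
      by (rule rtrancl_mono[THEN subsetD, rotated]) (auto simp: R_def)
    then show ?thesis by (rule rtrancl_imp_relpow)
  qed
  then obtain n where n: "\<And>i. (i, k) \<in> R ^^ n i" by metis
  \<comment> \<open>The sum exceeds every individual length, and \<open>Suc\<close> guarantees N >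
    0, hence d = N \<delta> > 0.\<close>
  define N where "N = Suc (\<Sum>i\<in>UNIV. n i)"
  have N: "(i, k) \<in> R ^^ N" for i
  proof -
    have "n i \<le> N" unfolding N_def by (simp add: le_SucI member_le_sum)
    moreover have "(k, k) \<in> R ^^ m" for m
      by (induction m) (use ne in auto)
    ultimately show ?thesis using n[of i] relpow_add[of "n i" "N - n i" R] by auto
  qed
  show ?thesis
  proof
    show "0 < N * \<delta>" using \<delta>(1) by (simp add: N_def del: of_nat_Suc)
    show "0 < \<rho> ^ N" using \<rho>0 by simp
    fix s E assume s: "0 \<le> s" and E: "E \<in> sets (past s)"
    let ?A = "{\<omega> \<in> E. \<phi> (s + N * \<delta>) \<omega> = k}"
    have "\<rho> ^ N * prob E = (\<Sum>i\<in>UNIV. \<rho> ^ N * prob {\<omega> \<in> E. \<phi> s \<omega> = i})"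
      using prob_split_phase[OF past_sets[OF E] s] by (simp add: sum_distrib_left)
    also have "\<dots> \<le> (\<Sum>i\<in>UNIV. prob {\<omega> \<in> E. \<phi> s \<omega> = i \<and> \<phi> (s + N * \<delta>) \<omega> = k})"
      by (intro sum_mono prob_path_ge[OF _ _ \<rho> s E N]) (use \<delta>(1) \<rho>0 in auto)
    also have "\<dots> = (\<Sum>i\<in>UNIV. prob {\<omega> \<in> ?A. \<phi> s \<omega> = i})"
      by (intro sum.cong refl arg_cong[where f = prob]) auto
    also have "\<dots> = prob ?A"
      using s \<delta>(1) past_sets[OF E] by (intro prob_split_phase[symmetric] sets_phase_cond) auto
    finally show "\<rho> ^ N * prob E \<le> prob ?A" .
  qed
qed

lemma filterlim_two_power: "filterlim (\<lambda>n::nat. 2 ^ n :: nat) at_top sequentially"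
  by (rule filterlim_subseq) (simp add: strict_mono_def)

text \<open>By right constancy the phase at u is the phase at some dyadic point after u. Rounding
  strictly upwards from a time before s + L may land on s + L itself, which is why j = 2^n is among
  the grid indices.\<close>

lemma phase_const_of_dyadic:
  assumes \<omega>: "\<omega> \<in> space M" and s: "0 \<le> s" and L: "0 < L"
    and k: "\<And>n j. j \<le> 2 ^ n \<Longrightarrow> \<phi> (s + real j * (L / 2 ^ n)) \<omega> = k"
    and u: "s \<le> u" "u < s + L"
  shows "\<phi> u \<omega> = k"
proof -
  define x where "x = u - s"
  define g where "g n = (of_int \<lfloor>x * (2 ^ n / L)\<rfloor> + 1) / (2 ^ n / L)" for n :: nat
  have x: "0 \<le> x" "x < L" using u by (auto simp: x_def)
  have "filterlim (\<lambda>n::nat. 2 ^ n / L) at_top sequentially"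
    using filterlim_tendsto_pos_mult_at_top[OF tendsto_const _ filterlim_compose[OF filterlim_real_sequentially filterlim_two_power], of "1 / L"]
      L by simp
  then have g: "filterlim g (at_right x) sequentially"
    unfolding g_def[abs_def] by (rule filterlim_grid_at_right)
  obtain d where d: "d > u" "\<And>r. u < r \<Longrightarrow> r < d \<Longrightarrow> \<phi> r \<omega> = \<phi> u \<omega>"
    using right_constant[OF \<omega>, of u] s u unfolding eventually_at_right_field by auto
  have "\<forall>\<^sub>F y in at_right x. \<phi> (s + y) \<omega> = \<phi> u \<omega>"
    unfolding eventually_at_right_field
    by (intro exI[of _ "d - s"]) (use d in \<open>auto simp: x_def\<close>)
  with g have "\<forall>\<^sub>F n in sequentially. \<phi> (s + g n) \<omega> = \<phi> u \<omega>"
    unfolding filterlim_iff by blast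
  then obtain n where n: "\<phi> (s + g n) \<omega> = \<phi> u \<omega>"
    using eventually_happens' sequentially_bot by blast
  define j where "j = nat (\<lfloor>x * (2 ^ n / L)\<rfloor> + 1)"
  have "x * (2 ^ n / L) < 2 ^ n" using x L by (simp add: field_simps)
  then have "\<lfloor>x * (2 ^ n / L)\<rfloor> < 2 ^ n" by (simp add: floor_less_iff)
  then have "j \<le> 2 ^ n" unfolding j_def by (simp add: nat_le_iff)
  have "0 \<le> \<lfloor>x * (2 ^ n / L)\<rfloor>" using x L by simp
  then have "real j = of_int \<lfloor>x * (2 ^ n / L)\<rfloor> + 1" by (simp add: j_def)
  then have "g n = real j * (L / 2 ^ n)" by (simp add: g_def)
  then show ?thesis using n k[OF \<open>j \<le> 2 ^ n\<close>] by simp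
qed

text \<open>
  Holding on the grid of mesh \<open>L / 2^n\<close> has probability at least \<open>(1 - K L / 2^n)^(2^n)\<close>, which tends
  to \<open>exp (- K L)\<close>.
\<close>

lemma prob_hold_ge:
  assumes L: "0 < L"
  obtains q where "0 < q"
    "\<And>s E. 0 \<le> s \<Longrightarrow> E \<in> sets (past s) \<Longrightarrow> \<exists>B\<in>sets M. B \<subseteq> E \<and>
       (\<forall>\<omega>\<in>B. \<forall>u\<in>{s..<s+L}. \<phi> u \<omega> = k) \<and> q * prob {\<omega> \<in> E. \<phi> s \<omega> = k} \<le> prob B"
proof -
  obtain K where K: "K > 0" "\<forall>\<^sub>F t in at_right 0. matrix_exp (t *\<^sub>R Q) $ k $ k \<ge> 1 - K * t"
    using matrix_exp_diag_ge by blast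
  let ?p = "\<lambda>n. matrix_exp ((L / 2 ^ n) *\<^sub>R Q) $ k $ k ^ (2 ^ n)"
  have \<eta>: "filterlim (\<lambda>n::nat. L / 2 ^ n) (at_right 0) sequentially"
  proof -
    have "(\<lambda>n. L * (1 / 2) ^ n) \<longlonglongrightarrow> L * 0" by (intro tendsto_mult tendsto_const LIMSEQ_power_zero) simp
    then show ?thesis using L by (simp add: filterlim_at power_one_over field_simps)
  qed
  have "\<forall>\<^sub>F n in sequentially. matrix_exp ((L / 2 ^ n) *\<^sub>R Q) $ k $ k \<ge> 1 - K * (L / 2 ^ n)"
    using K(2) \<eta> unfolding filterlim_iff by blast
  \<comment> \<open>The base must be nonnegative before the lower bound can be raised to the power
    2^n.\<close>
  moreover have "\<forall>\<^sub>F n in sequentially. 1 - K * (L / 2 ^ n) \<ge> 0"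
  proof -
    have "(\<lambda>n. 1 - K * (L / 2 ^ n)) \<longlonglongrightarrow> 1 - K * 0"
      using \<eta> by (intro tendsto_intros) (simp add: filterlim_at)
    then have "\<forall>\<^sub>F n in sequentially. 1 - K * (L / 2 ^ n) > 0" by (rule order_tendstoD) simp
    then show ?thesis by eventually_elim simp
  qed
  ultimately have le: "\<forall>\<^sub>F n in sequentially. (1 + (- (K * L)) / real (2 ^ n)) ^ (2 ^ n) \<le> ?p n"
  proof eventually_elim
    case (elim n)
    have "1 + (- (K * L)) / real (2 ^ n) = 1 - K * (L / 2 ^ n)" by simp
    then show ?case using power_mono[OF elim] by simp
  qed
  have lim: "(\<lambda>n. (1 + (- (K * L)) / real (2 ^ n)) ^ (2 ^ n)) \<longlonglongrightarrow> exp (- (K * L))"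
    by (rule filterlim_compose[OF tendsto_exp_limit_sequentially filterlim_two_power])
  show ?thesis
  proof
    show "0 < exp (- (K * L))" by simp
    fix s E assume s: "0 \<le> s" and E: "E \<in> sets (past s)"
    define A where "A \<eta> m = {\<omega> \<in> E. \<forall>j\<le>m. \<phi> (s + real j * \<eta>) \<omega> = k}" for \<eta> m
    have A_Suc: "A \<eta> (Suc m) = {\<omega> \<in> A \<eta> m. \<phi> (s + real m * \<eta> + \<eta>) \<omega> = k}" for \<eta> m
      by (auto simp: A_def le_Suc_eq algebra_simps)
    have A_0: "A \<eta> 0 = {\<omega> \<in> E. \<phi> s \<omega> = k}" for \<eta> by (simp add: A_def)
    have A_past: "A \<eta> m \<in> sets (past (s + real m * \<eta>))" if "0 \<le> \<eta>" for \<eta> m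
    proof (induction m)
      case 0
      show ?case unfolding A_0 using past_phase_cond[OF E, of s s k] s by simp
    next
      case (Suc m)
      show ?case unfolding A_Suc
        by (rule past_phase_cond[OF Suc.IH]) (use s that in \<open>auto simp: algebra_simps\<close>)
    qed
    \<comment> \<open>The event A already fixes the phase at its last grid point, so one further
      point multiplies the probability by exactly the diagonal entry.\<close>
    have A_prob: "prob (A \<eta> m) = prob {\<omega> \<in> E. \<phi> s \<omega> = k} * matrix_exp (\<eta> *\<^sub>R Q) $ k $ k ^ m"
      if "0 \<le> \<eta>" for \<eta> m
    proof (induction m)
      case 0
      show ?case by (simp add: A_0)
    next
      case (Suc m)
      let ?t = "s + real m * \<eta>"
      have "A \<eta> (Suc m) = {\<omega> \<in> A \<eta> m. \<phi> ?t \<omega> = k \<and> \<phi> (?t + \<eta>) \<omega> = k}"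
        unfolding A_Suc by (auto simp: A_def)
      then have "prob (A \<eta> (Suc m)) = prob {\<omega> \<in> A \<eta> m. \<phi> ?t \<omega> = k} * matrix_exp (\<eta> *\<^sub>R Q) $ k $ k"
        using markov[OF _ that A_past[OF that], of m k k] s that by simp
      also have "{\<omega> \<in> A \<eta> m. \<phi> ?t \<omega> = k} = A \<eta> m" by (auto simp: A_def)
      finally show ?case using Suc.IH by (simp add: mult_ac)
    qed
    let ?A = "\<lambda>n. A (L / 2 ^ n) (2 ^ n)"
    \<comment> \<open>Holding k throughout the interval is a condition at uncountably many times.
      Intersecting over the dyadic grids gives a set that is plainly measurable and still forces
      it.\<close>
    let ?B = "\<Inter>n. ?A n"
    have A_sets: "?A n \<in> sets M" for n
      using A_past[of "L / 2 ^ n" "2 ^ n"] L past_sets by simp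
    \<comment> \<open>Halving the mesh refines the grid, so the events decrease and their
      probabilities converge to that of the intersection.\<close>
    have dec: "decseq ?A"
    proof (rule decseq_SucI)
      fix n
      show "?A (Suc n) \<le> ?A n"
      proof
        fix \<omega> assume \<omega>: "\<omega> \<in> ?A (Suc n)"
        have "\<phi> (s + real j * (L / 2 ^ n)) \<omega> = k" if "j \<le> 2 ^ n" for j
        proof -
          have "2 * j \<le> 2 ^ Suc n" using that by simp
          then have "\<phi> (s + real (2 * j) * (L / 2 ^ Suc n)) \<omega> = k" using \<omega> unfolding A_def by blast
          then show ?thesis by simp
        qed
        then show "\<omega> \<in> ?A n" using \<omega> by (simp add: A_def)
      qed
    qed
    have "(\<lambda>n. prob (?A n)) \<longlonglongrightarrow> prob ?B"
      by (rule finite_Lim_measure_decseq[OF _ dec]) (use A_sets in auto)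
    moreover have "(\<lambda>n. prob {\<omega> \<in> E. \<phi> s \<omega> = k} * (1 + (- (K * L)) / real (2 ^ n)) ^ (2 ^ n))
        \<longlonglongrightarrow> prob {\<omega> \<in> E. \<phi> s \<omega> = k} * exp (- (K * L))"
      by (intro tendsto_mult tendsto_const lim)
    moreover have "\<forall>\<^sub>F n in sequentially.
        prob {\<omega> \<in> E. \<phi> s \<omega> = k} * (1 + (- (K * L)) / real (2 ^ n)) ^ (2 ^ n) \<le> prob (?A n)"
      using le
    proof eventually_elim
      case (elim n)
      then show ?case using L by (simp only: A_prob divide_nonneg_nonneg zero_le_power zero_le_numeral less_imp_le)
        (rule mult_left_mono, simp_all)
    qed
    ultimately have "prob {\<omega> \<in> E. \<phi> s \<omega> = k} * exp (- (K * L)) \<le> prob ?B"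
      by (intro tendsto_le[OF sequentially_bot])
    moreover have "?B \<in> sets M" using A_sets by blast
    moreover have "?B \<subseteq> E" by (auto simp: A_def)
    moreover have "\<forall>\<omega>\<in>?B. \<forall>u\<in>{s..<s+L}. \<phi> u \<omega> = k"
    proof (intro ballI)
      fix \<omega> u assume \<omega>: "\<omega> \<in> ?B" and u: "u \<in> {s..<s+L}"
      have "\<omega> \<in> space M" using \<omega> A_sets sets.sets_into_space by blast
      moreover have "\<phi> (s + real j * (L / 2 ^ n)) \<omega> = k" if "j \<le> 2 ^ n" for n j
      proof -
        have "\<omega> \<in> ?A n" using \<omega> by blast
        then show ?thesis using that by (simp add: A_def)
      qed
      ultimately show "\<phi> u \<omega> = k"
        using s L u by (intro phase_const_of_dyadic[of \<omega> s L k u]) auto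
    qed
    ultimately show "\<exists>B\<in>sets M. B \<subseteq> E \<and> (\<forall>\<omega>\<in>B. \<forall>u\<in>{s..<s+L}. \<phi> u \<omega> = k) \<and>
        exp (- (K * L)) * prob {\<omega> \<in> E. \<phi> s \<omega> = k} \<le> prob B"
      by (intro bexI[of _ ?B]) (auto simp: mult.commute)
  qed
qed

end

subsection \<open>Passage and exit times\<close>

text \<open>Used to replace real times by rational ones, so that conditions on whole paths become
  countable.\<close>

lemma eventually_at_right_Rats:
  fixes t :: real
  assumes "\<forall>\<^sub>F r in at_right t. P r"
  shows "\<exists>r\<in>\<rat>. t < r \<and> P r"
proof -
  obtain d where "d > t" "\<And>r. t < r \<Longrightarrow> r < d \<Longrightarrow> P r"
    using assms unfolding eventually_at_right_field by auto
  then show ?thesis using Rats_dense_in_real[of t d] by blast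
qed

context right_constant_process
begin

lemma level_uminus: "level (- c) t \<omega> = - level c t \<omega>"
  by (simp add: level_def set_lebesgue_integral_def)

lemma tendsto_level_right:
  assumes "\<omega> \<in> space M" "0 \<le> t"
  shows "((\<lambda>r. level c r \<omega>) \<longlongrightarrow> level c t \<omega>) (at_right t)"
proof -
  have "((\<lambda>r. level c r \<omega>) \<longlongrightarrow> level c t \<omega>) (at t within {0..})"
    using continuous_on_level[OF assms(1), of c] assms(2) by (auto simp: continuous_on_def)
  then show ?thesis
    by (rule tendsto_within_subset) (use assms(2) in auto)
qed

definition first_passage :: "real^'s \<Rightarrow> real \<Rightarrow> 'w \<Rightarrow> ereal" where
  "first_passage c x \<omega> = (INF t\<in>{t. 0 \<le> t \<and> x < level c t \<omega>}. ereal t)"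

lemma first_passage_nonneg: "0 \<le> first_passage c x \<omega>"
  unfolding first_passage_def by (intro INF_greatest) auto

text \<open>The level is continuous, so an excess over x at a time t < y persists just afterwards
  and is witnessed at a rational time before y.\<close>

lemma measurable_first_passage: "first_passage c x \<in> borel_measurable M"
proof (rule borel_measurableI_less)
  fix y :: ereal
  have "{\<omega> \<in> space M. first_passage c x \<omega> < y} =
      {\<omega> \<in> space M. \<exists>r\<in>\<rat> \<inter> {0..}. x < level c r \<omega> \<and> ereal r < y}"
  proof (intro Collect_cong conj_cong refl iffI)
    fix \<omega> assume \<omega>: "\<omega> \<in> space M"
    {
      assume "first_passage c x \<omega> < y"
      then obtain t where t: "0 \<le> t" "x < level c t \<omega>" "ereal t < y"
        by (auto simp: first_passage_def INF_less_iff)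
      have "\<forall>\<^sub>F r in at_right t. x < level c r \<omega>"
        by (rule order_tendstoD(1)[OF tendsto_level_right[OF \<omega> t(1)] t(2)])
      moreover have "\<forall>\<^sub>F r in at_right t. ereal r < y"
        by (rule order_tendstoD(2)[OF _ t(3)]) (intro tendsto_intros)
      ultimately have "\<forall>\<^sub>F r in at_right t. x < level c r \<omega> \<and> ereal r < y"
        by (rule eventually_conj)
      then obtain r where "r \<in> \<rat>" "t < r" "x < level c r \<omega> \<and> ereal r < y"
        using eventually_at_right_Rats by blast
      then show "\<exists>r\<in>\<rat> \<inter> {0..}. x < level c r \<omega> \<and> ereal r < y"
        using t(1) by (intro bexI[of _ r]) auto
    next
      assume "\<exists>r\<in>\<rat> \<inter> {0..}. x < level c r \<omega> \<and> ereal r < y"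
      then show "first_passage c x \<omega> < y"
        by (auto simp: first_passage_def INF_less_iff)
    }
  qed
  also have "\<dots> \<in> sets M"
  proof (rule sets.sets_Collect_countable_Ex')
    show "countable (\<rat> \<inter> {0..} :: real set)" by (simp add: countable_rat)
    fix r :: real
    show "{\<omega> \<in> space M. x < level c r \<omega> \<and> ereal r < y} \<in> sets M"
      using measurable_level[of c r] by measurable
  qed
  finally show "{\<omega> \<in> space M. first_passage c x \<omega> < y} \<in> sets M" .
qed

text \<open>
  Passage below \<open>-a\<close> is passage above \<open>a\<close> for the rates \<open>-c\<close>. For an infinite passage time
  \<^const>\<open>real_of_ereal\<close> gives \<open>0\<close>, which the strict inequality excludes.
\<close>

definition passage_event :: "real^'s \<Rightarrow> real \<Rightarrow> real \<Rightarrow> 's \<Rightarrow> 'w set" where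
  "passage_event c a b j = {\<omega> \<in> space M. first_passage c b \<omega> < first_passage (- c) a \<omega> \<and>
     \<phi> (real_of_ereal (first_passage c b \<omega>)) \<omega> = j}"

lemma sets_passage_event: "passage_event c a b j \<in> sets M"
proof -
  have [measurable]: "first_passage c b \<in> borel_measurable M" "first_passage (- c) a \<in> borel_measurable M"
    by (rule measurable_first_passage)+
  have [measurable]: "(\<lambda>\<omega>. \<phi> (real_of_ereal (first_passage c b \<omega>)) \<omega>) \<in> M \<rightarrow>\<^sub>M count_space UNIV"
    by (rule measurable_time_change) (use first_passage_nonneg in \<open>auto simp: real_of_ereal_pos\<close>)
  show ?thesis unfolding passage_event_def by measurable
qed

section \<open>Staying in the interval and leaving it\<close>

text \<open>Time s itself is left out: for a path that leaves the interval, membership then means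
  exactly that s is at most the exit time.\<close>

definition inside_until :: "real^'s \<Rightarrow> real \<Rightarrow> real \<Rightarrow> real \<Rightarrow> 'w set" where
  "inside_until c a b s = {\<omega> \<in> space M. \<forall>t\<in>{0..<s}. level c t \<omega> \<in> {-a..b}}"

text \<open>The complement of the closed interval is open, so being outside at a time t < s implies
  being outside at some rational time between t and s. Countably many levels before s therefore
  decide the event.\<close>

lemma inside_until_past: "inside_until c a b s \<in> sets (past s)"
proof -
  have "inside_until c a b s = {\<omega> \<in> space M. \<forall>r\<in>\<rat> \<inter> {0..<s}. level c r \<omega> \<in> {-a..b}}"
    unfolding inside_until_def
  proof (intro Collect_cong conj_cong refl iffI)
    fix \<omega> assume \<omega>: "\<omega> \<in> space M" and *: "\<forall>r\<in>\<rat> \<inter> {0..<s}. level c r \<omega> \<in> {-a..b}"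
    show "\<forall>t\<in>{0..<s}. level c t \<omega> \<in> {-a..b}"
    proof (rule ballI, rule ccontr)
      fix t assume t: "t \<in> {0..<s}" and out: "level c t \<omega> \<notin> {-a..b}"
      have lt: "\<forall>\<^sub>F r in at_right t. r < s"
        using t by (intro eventually_at_rightI[of t s]) auto
      have "open (- {-a..b})" by (intro open_Compl closed_atLeastAtMost)
      then have "\<forall>\<^sub>F r in at_right t. level c r \<omega> \<in> - {-a..b}"
        using out t by (intro topological_tendstoD[OF tendsto_level_right[OF \<omega>]]) auto
      with lt have "\<forall>\<^sub>F r in at_right t. r < s \<and> level c r \<omega> \<in> - {-a..b}"
        by (rule eventually_conj)
      then obtain r where "r \<in> \<rat>" "t < r" "r < s" "level c r \<omega> \<in> - {-a..b}"
        using eventually_at_right_Rats by blast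
      then show False using * t by auto
    qed
  qed auto
  also have "\<dots> = {\<omega> \<in> space (past s). \<forall>r\<in>\<rat> \<inter> {0..<s}. level c r \<omega> \<in> {-a..b}}" by simp
  also have "\<dots> \<in> sets (past s)"
  proof (rule sets.sets_Collect_countable_All')
    show "countable (\<rat> \<inter> {0..<s} :: real set)" by (simp add: countable_rat)
    fix r assume "r \<in> \<rat> \<inter> {0..<s}"
    then have "level c r \<in> borel_measurable (past s)"
      by (intro measurable_level_past) auto
    then show "{\<omega> \<in> space (past s). level c r \<omega> \<in> {-a..b}} \<in> sets (past s)"
      by measurable
  qed
  finally show ?thesis .
qed

text \<open>A real infimum, hence meaningful only for paths that do leave; this is the standing
  assumption \<open>exits\<close> below, which holds almost surely.\<close>

definition exit_time :: "real^'s \<Rightarrow> real \<Rightarrow> real \<Rightarrow> 'w \<Rightarrow> real" where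
  "exit_time c a b \<omega> = Inf {t. 0 \<le> t \<and> level c t \<omega> \<notin> {-a..b}}"

context
  fixes c a b \<omega>
  assumes \<omega>: "\<omega> \<in> space M" and a: "0 \<le> a" and b: "0 \<le> b"
    and exits: "\<exists>t\<ge>0. level c t \<omega> \<notin> {-a..b}"
begin

abbreviation "\<tau> \<equiv> exit_time c a b \<omega>"

lemma exit_time_nonneg: "0 \<le> \<tau>"
  unfolding exit_time_def by (rule cInf_greatest) (use exits in auto)

lemma level_before_exit:
  assumes "0 \<le> t" "t < \<tau>"
  shows "level c t \<omega> \<in> {-a..b}"
proof (rule ccontr)
  assume "level c t \<omega> \<notin> {-a..b}"
  then have "\<tau> \<le> t"
    unfolding exit_time_def by (intro cInf_lower bdd_belowI[of _ 0]) (use assms in auto)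
  then show False using assms by simp
qed

lemma exit_near:
  assumes "0 < d"
  obtains t where "\<tau> \<le> t" "t < \<tau> + d" "level c t \<omega> \<notin> {-a..b}"
proof -
  have "\<exists>t\<in>{t. 0 \<le> t \<and> level c t \<omega> \<notin> {-a..b}}. t < \<tau> + d"
    using exits assms unfolding exit_time_def
    by (intro cInf_lessD) auto
  then obtain t where t: "0 \<le> t" "level c t \<omega> \<notin> {-a..b}" "t < \<tau> + d" by auto
  then have "\<tau> \<le> t" using level_before_exit[of t] by force
  then show ?thesis using t that by blast
qed

lemma level_at_exit: "level c \<tau> \<omega> \<in> {-a..b}"
proof (cases "\<tau> = 0")
  case True
  then show ?thesis using a b by (simp add: level_0)
next
  case False
  then have pos: "0 < \<tau>" using exit_time_nonneg by simp
  have "((\<lambda>t. level c t \<omega>) \<longlongrightarrow> level c \<tau> \<omega>) (at \<tau> within {0..})"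
    using continuous_on_level[OF \<omega>, of c] pos by (auto simp: continuous_on_def)
  then have lim: "((\<lambda>t. level c t \<omega>) \<longlongrightarrow> level c \<tau> \<omega>) (at \<tau> within {0<..<\<tau>})"
    by (rule tendsto_within_subset) auto
  have nt: "at \<tau> within {0<..<\<tau>} \<noteq> bot"
    using pos by (simp add: trivial_limit_within islimpt_greaterThanLessThan2)
  have ev: "\<forall>\<^sub>F t in at \<tau> within {0<..<\<tau>}. level c t \<omega> \<in> {-a..b}"
    unfolding eventually_at_filter by (rule always_eventually) (use level_before_exit in auto)
  show ?thesis
    by (rule Lim_in_closed_set[OF closed_atLeastAtMost ev nt lim])
qed

lemma mem_inside_until_iff: "\<omega> \<in> inside_until c a b s \<longleftrightarrow> s \<le> \<tau>"
proof
  assume w: "\<omega> \<in> inside_until c a b s"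
  show "s \<le> \<tau>"
  proof (rule ccontr)
    assume "\<not> s \<le> \<tau>"
    then obtain t where "\<tau> \<le> t" "t < \<tau> + (s - \<tau>)" "level c t \<omega> \<notin> {-a..b}"
      using exit_near[of "s - \<tau>"] by auto
    then show False using w exit_time_nonneg by (auto simp: inside_until_def)
  qed
next
  assume "s \<le> \<tau>"
  then show "\<omega> \<in> inside_until c a b s"
    using \<omega> level_before_exit by (auto simp: inside_until_def simp del: atLeastAtMost_iff)
qed

text \<open>At rate zero the level would keep its value at the exit time, which lies in the
  interval, for a while; yet there are times outside arbitrarily soon after the exit time.\<close>

lemma exit_rate_nonzero: "c $ \<phi> \<tau> \<omega> \<noteq> 0"
proof
  assume 0: "c $ \<phi> \<tau> \<omega> = 0"
  obtain e where e: "e > 0" "\<And>u. u \<in> {\<tau>..\<tau>+e} \<Longrightarrow> level c u \<omega> = level c \<tau> \<omega> + c $ \<phi> \<tau> \<omega> * (u - \<tau>)"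
    using level_locally_linear[OF \<omega> exit_time_nonneg, of c] by blast
  obtain t where "\<tau> \<le> t" "t < \<tau> + e" "level c t \<omega> \<notin> {-a..b}" using exit_near[OF e(1)] .
  then show False using e(2)[of t] 0 level_at_exit by simp
qed

text \<open>Right after the exit time the level rises linearly from a point of the interval, so it
  stays above -a for a further time e. Nearby times outside must then lie above b, and passage below
  -a comes at least e later, which makes the last inequality strict.\<close>

lemma exit_upwards:
  assumes pos: "0 < c $ \<phi> \<tau> \<omega>"
  shows "level c \<tau> \<omega> = b" "first_passage c b \<omega> = ereal \<tau>" "ereal \<tau> < first_passage (- c) a \<omega>"
proof -
  obtain e where e: "e > 0" "\<And>u. u \<in> {\<tau>..\<tau>+e} \<Longrightarrow> level c u \<omega> = level c \<tau> \<omega> + c $ \<phi> \<tau> \<omega> * (u - \<tau>)"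
    using level_locally_linear[OF \<omega> exit_time_nonneg, of c] by blast
  have ge: "-a \<le> level c u \<omega>" if "0 \<le> u" "u \<le> \<tau> + e" for u
  proof (cases "u < \<tau>")
    case True
    then show ?thesis using level_before_exit[of u] that by simp
  next
    case False
    then have "0 \<le> c $ \<phi> \<tau> \<omega> * (u - \<tau>)" using pos by simp
    then show ?thesis using e(2)[of u] level_at_exit False that by simp
  qed
  have above: "\<exists>t. \<tau> \<le> t \<and> t < \<tau> + d \<and> t \<le> \<tau> + e \<and> b < level c t \<omega>" if "0 < d" for d
  proof -
    have "0 < min d e" using that e(1) by simp
    then obtain t where t: "\<tau> \<le> t" "t < \<tau> + min d e" "level c t \<omega> \<notin> {-a..b}"
      by (rule exit_near)
    then show ?thesis using ge[of t] exit_time_nonneg by (intro exI[of _ t]) auto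
  qed
  show "level c \<tau> \<omega> = b"
  proof (rule antisym)
    show "b \<le> level c \<tau> \<omega>"
    proof (rule ccontr)
      assume "\<not> b \<le> level c \<tau> \<omega>"
      \<comment> \<open>At this slope the level needs time (b - level) / rate to reach b, so it
        cannot exceed b earlier.\<close>
      then obtain t where t: "\<tau> \<le> t" "t < \<tau> + (b - level c \<tau> \<omega>) / c $ \<phi> \<tau> \<omega>" "t \<le> \<tau> + e" "b < level c t \<omega>"
        using above[of "(b - level c \<tau> \<omega>) / c $ \<phi> \<tau> \<omega>"] pos by auto
      then show False using e(2)[of t] pos by (simp add: field_simps)
    qed
  qed (use level_at_exit in simp)
  have le: "level c t \<omega> \<le> b" if "0 \<le> t" "t \<le> \<tau>" for t
    using level_before_exit[of t] level_at_exit that by (cases "t = \<tau>") auto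
  show "first_passage c b \<omega> = ereal \<tau>"
  proof (rule antisym)
    show "first_passage c b \<omega> \<le> ereal \<tau>"
    proof (rule ereal_le_epsilon2)
      fix d :: real assume "0 < d"
      then obtain t where t: "\<tau> \<le> t" "t < \<tau> + d" "b < level c t \<omega>" using above by blast
      have "first_passage c b \<omega> \<le> ereal t"
        unfolding first_passage_def by (rule INF_lower) (use t exit_time_nonneg in auto)
      then show "first_passage c b \<omega> \<le> ereal \<tau> + ereal d"
        using t by (simp add: order_trans[of _ "ereal t"])
    qed
    show "ereal \<tau> \<le> first_passage c b \<omega>"
      unfolding first_passage_def by (rule INF_greatest) (use le in force)
  qed
  have "ereal (\<tau> + e) \<le> first_passage (- c) a \<omega>"
    unfolding first_passage_def level_uminus by (rule INF_greatest) (use ge in force)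
  then show "ereal \<tau> < first_passage (- c) a \<omega>"
    using e(1) by (auto intro: less_le_trans[rotated])
qed

end

end

subsection \<open>Optional stopping at the exit time\<close>

context right_constant_process
begin

text \<open>Reflecting the level exchanges the two boundaries, which reduces downward exits to
  upward ones.\<close>

lemma exit_time_uminus: "exit_time (- c) b a \<omega> = exit_time c a b \<omega>"
proof -
  have "level (- c) t \<omega> \<notin> {-b..a} \<longleftrightarrow> level c t \<omega> \<notin> {-a..b}" for t
    by (auto simp: level_uminus)
  then show ?thesis by (simp add: exit_time_def del: atLeastAtMost_iff)
qed

lemma exit_downwards:
  assumes \<omega>: "\<omega> \<in> space M" and a: "0 \<le> a" and b: "0 \<le> b"
    and exits: "\<exists>t\<ge>0. level c t \<omega> \<notin> {-a..b}"
    and neg: "c $ \<phi> (exit_time c a b \<omega>) \<omega> < 0"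
  shows "level c (exit_time c a b \<omega>) \<omega> = -a"
    "first_passage (- c) a \<omega> = ereal (exit_time c a b \<omega>)"
    "ereal (exit_time c a b \<omega>) < first_passage c b \<omega>"
proof -
  have exits': "\<exists>t\<ge>0. level (- c) t \<omega> \<notin> {-b..a}"
    using exits by (auto simp: level_uminus)
  note up = exit_upwards[OF \<omega> b a exits', unfolded exit_time_uminus]
  show "level c (exit_time c a b \<omega>) \<omega> = -a"
    "first_passage (- c) a \<omega> = ereal (exit_time c a b \<omega>)"
    "ereal (exit_time c a b \<omega>) < first_passage c b \<omega>"
    using up neg by (simp_all add: level_uminus)
qed

end

context markov_process
begin

text \<open>Whatever happened before s, with probability at least p q the phase is k at s + d and
  then stays there for time L, which drives the level out. Each period of length T thus loses a
  fixed proportion of the remaining paths.\<close>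

lemma prob_inside_until_geometric:
  assumes irr: "irreducible_generator Q" and k: "0 < c $ k" and a: "0 \<le> a" and b: "0 \<le> b"
  obtains T r where "0 < T" "0 \<le> r" "r < 1" "\<And>n. prob (inside_until c a b (real n * T)) \<le> r ^ n"
proof -
  \<comment> \<open>Holding k for time L raises the level by a + b + 1, more than the length of the
    interval.\<close>
  define L where "L = (a + b + 1) / c $ k"
  have L: "0 < L" using k a b by (simp add: L_def)
  obtain d p where d: "0 < d" and p: "0 < p"
    and reach: "\<And>s E. 0 \<le> s \<Longrightarrow> E \<in> sets (past s) \<Longrightarrow> p * prob E \<le> prob {\<omega> \<in> E. \<phi> (s + d) \<omega> = k}"
    using prob_reach_ge[OF irr, of k] by blast
  obtain q where q: "0 < q" and hold: "\<And>s E. 0 \<le> s \<Longrightarrow> E \<in> sets (past s) \<Longrightarrow> \<exists>B\<in>sets M. B \<subseteq> E \<and>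
       (\<forall>\<omega>\<in>B. \<forall>u\<in>{s..<s+L}. \<phi> u \<omega> = k) \<and> q * prob {\<omega> \<in> E. \<phi> s \<omega> = k} \<le> prob B"
    using prob_hold_ge[OF L, of k] by blast
  \<comment> \<open>The extra 1 puts s + d + L strictly before s + T, inside the half-open window
    tested by \<open>inside_until\<close>.\<close>
  define T where "T = d + L + 1"
  have T: "0 < T" using d L by (simp add: T_def)
  have step: "prob (inside_until c a b (s + T)) \<le> (1 - q * p) * prob (inside_until c a b s)" if s: "0 \<le> s" for s
  proof -
    let ?E = "inside_until c a b s"
    have E: "?E \<in> sets (past s)" by (rule inside_until_past)
    then have E': "?E \<in> sets (past (s + d))" using past_mono[of s "s + d"] d by auto
    obtain B where B: "B \<in> sets M" "B \<subseteq> ?E" "\<And>\<omega> u. \<omega> \<in> B \<Longrightarrow> u \<in> {s+d..<s+d+L} \<Longrightarrow> \<phi> u \<omega> = k"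
      "q * prob {\<omega> \<in> ?E. \<phi> (s + d) \<omega> = k} \<le> prob B"
      using hold[OF _ E'] s d by auto
    have disj: "inside_until c a b (s + T) \<inter> B = {}"
    proof (rule equals0I)
      fix \<omega> assume \<omega>: "\<omega> \<in> inside_until c a b (s + T) \<inter> B"
      then have "\<omega> \<in> space M" using B(1) sets.sets_into_space by blast
      then have "level c (s + d + L) \<omega> = level c (s + d) \<omega> + c $ k * (s + d + L - (s + d))"
        using s d L \<omega> by (intro level_const_phase) (auto intro!: B(3))
      moreover have "c $ k * L = a + b + 1" using k by (simp add: L_def)
      moreover have "level c (s + d + L) \<omega> \<in> {-a..b}" "level c (s + d) \<omega> \<in> {-a..b}"
        using \<omega> s d L by (auto simp: inside_until_def T_def simp del: atLeastAtMost_iff)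
      ultimately show False by simp
    qed
    have sub: "inside_until c a b (s + T) \<subseteq> ?E - B"
      using disj T by (auto simp: inside_until_def simp del: atLeastAtMost_iff)
    have "prob (inside_until c a b (s + T)) \<le> prob (?E - B)"
      by (rule finite_measure_mono[OF sub]) (use past_sets[OF E] B(1) in auto)
    also have "\<dots> = prob ?E - prob B"
      by (rule finite_measure_Diff[OF past_sets[OF E] B(1,2)])
    also have "\<dots> \<le> prob ?E - q * (p * prob ?E)"
      using B(4) mult_left_mono[OF reach[OF s E], of q] q by linarith
    finally show ?thesis by (simp add: algebra_simps)
  qed
  show ?thesis
  proof
    \<comment> \<open>Truncation at 0 makes the ratio nonnegative without a separate proof that q p
      is at most 1.\<close>
    let ?r = "max 0 (1 - q * p)"
    show "0 < T" by (rule T)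
    show "0 \<le> ?r" by simp
    show "?r < 1" using p q by simp
    show "prob (inside_until c a b (real n * T)) \<le> ?r ^ n" for n
    proof (induction n)
      case 0
      show ?case by simp
    next
      case (Suc n)
      let ?p = "prob (inside_until c a b (real n * T))"
      have "prob (inside_until c a b (real n * T + T)) \<le> (1 - q * p) * ?p"
        using step[of "real n * T"] T by simp
      also have "\<dots> \<le> ?r * ?p" by (rule mult_right_mono) simp_all
      also have "\<dots> \<le> ?r * ?r ^ n" by (rule mult_left_mono[OF Suc.IH]) simp
      finally show ?case by (simp add: algebra_simps)
    qed
  qed
qed

lemma AE_exits:
  assumes "irreducible_generator Q" "0 < c $ k" "0 \<le> a" "0 \<le> b"
  shows "AE \<omega> in M. \<exists>t\<ge>0. level c t \<omega> \<notin> {-a..b}"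
proof -
  obtain T r where T: "0 < T" and r: "0 \<le> r" "r < 1"
    and le: "\<And>n. prob (inside_until c a b (real n * T)) \<le> r ^ n"
    using prob_inside_until_geometric[OF assms] by blast
  let ?N = "\<Inter>n. inside_until c a b (real n * T)"
  have sets: "inside_until c a b s \<in> sets M" for s
    using inside_until_past by (rule past_sets)
  have N: "?N \<in> sets M" using sets by blast
  have "prob ?N \<le> r ^ n" for n
    by (rule order_trans[OF finite_measure_mono le]) (use sets in auto)
  then have "prob ?N \<le> 0"
    using r by (intro LIMSEQ_le_const[OF LIMSEQ_power_zero[of r]]) auto
  then have "?N \<in> null_sets M"
    using N by (simp add: null_sets_def emeasure_eq_measure measure_le_0_iff)
  then have "AE \<omega> in M. \<omega> \<notin> ?N" by (rule AE_not_in)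
  then show ?thesis
  proof (rule AE_mp, intro AE_I2 impI)
    fix \<omega> assume "\<omega> \<in> space M" "\<omega> \<notin> ?N"
    then obtain n where "\<omega> \<in> space M" "\<omega> \<notin> inside_until c a b (real n * T)" by blast
    then obtain t where "t \<in> {0..<real n * T}" "level c t \<omega> \<notin> {-a..b}"
      unfolding inside_until_def by blast
    then show "\<exists>t\<ge>0. level c t \<omega> \<notin> {-a..b}" by (intro exI[of _ t] conjI) simp_all
  qed
qed

text \<open>
  The martingale stopped at the first grid time strictly after the exit time, for the grid of mesh
  \<open>1 / (n + 1)\<close>, or at time \<open>n + 1\<close> if that comes first.
\<close>

definition stopped_sum :: "real^'s \<Rightarrow> real^'s \<Rightarrow> real \<Rightarrow> real \<Rightarrow> nat \<Rightarrow> 'w \<Rightarrow> real" where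
  "stopped_sum c h a b n \<omega> = drift_martingale c h 0 \<omega> +
     (\<Sum>i<Suc n * Suc n. indicator (inside_until c a b (real i / real (Suc n))) \<omega> *
        (drift_martingale c h (real i / real (Suc n) + 1 / real (Suc n)) \<omega> -
         drift_martingale c h (real i / real (Suc n)) \<omega>))"

lemma integrable_stopped_increment:
  assumes "0 \<le> s" "0 \<le> t" "E \<in> sets M"
  shows "integrable M (\<lambda>\<omega>. indicator E \<omega> * (drift_martingale c h (s + t) \<omega> - drift_martingale c h s \<omega>))"
  using assms
  by (intro integrable_mult_indicator[where 'b = real, unfolded real_scaleR_def] Bochner_Integration.integrable_diff
      integrable_drift_martingale) auto

text \<open>Discrete optional stopping: every increment is weighted by an event known at the left
  end of its cell, so only the initial value contributes to the mean.\<close>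

lemma integral_stopped_sum:
  assumes "Q *v h = - c"
  shows "(LINT \<omega>|M. stopped_sum c h a b n \<omega>) = (LINT \<omega>|M. h $ \<phi> 0 \<omega>)"
    and "integrable M (stopped_sum c h a b n)"
proof -
  let ?d = "\<lambda>i \<omega>. indicator (inside_until c a b (real i / real (Suc n))) \<omega> *
        (drift_martingale c h (real i / real (Suc n) + 1 / real (Suc n)) \<omega> -
         drift_martingale c h (real i / real (Suc n)) \<omega>)"
  have d: "integrable M (?d i)" for i
    by (intro integrable_stopped_increment past_sets[OF inside_until_past]) auto
  have d0: "(LINT \<omega>|M. ?d i \<omega>) = 0" for i
    by (intro drift_martingale_increment assms inside_until_past) auto
  have 0: "integrable M (drift_martingale c h 0)"
    by (rule integrable_drift_martingale) simp
  show "integrable M (stopped_sum c h a b n)"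
    unfolding stopped_sum_def[abs_def]
    by (intro Bochner_Integration.integrable_add Bochner_Integration.integrable_sum 0 d)
  have "(LINT \<omega>|M. stopped_sum c h a b n \<omega>) =
      (LINT \<omega>|M. drift_martingale c h 0 \<omega>) + (\<Sum>i<Suc n * Suc n. LINT \<omega>|M. ?d i \<omega>)"
    unfolding stopped_sum_def
    by (simp only: Bochner_Integration.integral_add Bochner_Integration.integral_sum
        Bochner_Integration.integrable_sum 0 d)
  also have "\<dots> = (LINT \<omega>|M. drift_martingale c h 0 \<omega>)"
    by (simp only: d0 sum.neutral_const add_0_right)
  finally show "(LINT \<omega>|M. stopped_sum c h a b n \<omega>) = (LINT \<omega>|M. h $ \<phi> 0 \<omega>)"
    by (simp add: drift_martingale_def level_0)
qed

context
  fixes c a b \<omega>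
  assumes \<omega>: "\<omega> \<in> space M" and a: "0 \<le> a" and b: "0 \<le> b"
    and exits: "\<exists>t\<ge>0. level c t \<omega> \<notin> {-a..b}"
begin

text \<open>The weight of cell i is 1 exactly when i / (n + 1) is at most the exit time, so the sum
  telescopes. A grid point equal to the exit time still counts, hence the + 1 after the
  floor.\<close>

lemma stopped_sum_eq:
  defines "t \<equiv> exit_time c a b \<omega>"
  shows "stopped_sum c h a b n \<omega> =
    drift_martingale c h (real (min (Suc n * Suc n) (nat \<lfloor>t * real (Suc n)\<rfloor> + 1)) / real (Suc n)) \<omega>"
proof -
  let ?m = "\<lambda>i. drift_martingale c h (real i / real (Suc n)) \<omega>"
  let ?K = "Suc n * Suc n" and ?L = "nat \<lfloor>t * real (Suc n)\<rfloor> + 1"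
  have t: "0 \<le> t" unfolding t_def by (rule exit_time_nonneg[OF \<omega> a b exits])
  have ind: "indicator (inside_until c a b (real i / real (Suc n))) \<omega> = (if i < ?L then 1 else 0 :: real)" for i
  proof -
    have "\<omega> \<in> inside_until c a b (real i / real (Suc n)) \<longleftrightarrow> real i / real (Suc n) \<le> t"
      unfolding t_def by (rule mem_inside_until_iff[OF \<omega> a b exits])
    also have "\<dots> \<longleftrightarrow> real i \<le> t * real (Suc n)" by (rule pos_divide_le_eq) simp
    also have "\<dots> \<longleftrightarrow> int i \<le> \<lfloor>t * real (Suc n)\<rfloor>" by (simp add: le_floor_iff del: of_nat_Suc)
    also have "\<dots> \<longleftrightarrow> i < ?L"
    proof -
      have "0 \<le> \<lfloor>t * real (Suc n)\<rfloor>" using t by simp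
      then show ?thesis by (simp add: nat_le_iff[symmetric] less_Suc_eq_le del: of_nat_Suc) linarith
    qed
    finally show ?thesis by (simp add: indicator_def)
  qed
  have Suc_step: "real i / real (Suc n) + 1 / real (Suc n) = real (Suc i) / real (Suc n)" for i
    by (simp only: of_nat_Suc add_divide_distrib add.commute)
  have "(if i < ?L then 1 else 0) * (?m (Suc i) - ?m i) = (if i < ?L then ?m (Suc i) - ?m i else 0)" for i
    by simp
  then have "stopped_sum c h a b n \<omega> = ?m 0 + (\<Sum>i<?K. if i < ?L then ?m (Suc i) - ?m i else 0)"
    unfolding stopped_sum_def ind Suc_step by (simp only: of_nat_0 div_0)
  also have "(\<Sum>i<?K. if i < ?L then ?m (Suc i) - ?m i else 0) = (\<Sum>i<min ?K ?L. ?m (Suc i) - ?m i)"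
    by (intro sum.mono_neutral_cong_right) auto
  also have "\<dots> = ?m (min ?K ?L) - ?m 0"
    by (rule sum_lessThan_telescope)
  finally show ?thesis by simp
qed

text \<open>Up to the exit time the level is in the interval. Rounding overshoots by at most 1,
  during which the level moves by at most \<open>norm c\<close>. The bound does not depend on n, as
  dominated convergence requires.\<close>

lemma abs_stopped_sum_le: "\<bar>stopped_sum c h a b n \<omega>\<bar> \<le> a + b + norm c + norm h"
proof -
  define t where "t = exit_time c a b \<omega>"
  define u where "u = real (min (Suc n * Suc n) (nat \<lfloor>t * real (Suc n)\<rfloor> + 1)) / real (Suc n)"
  have t: "0 \<le> t" unfolding t_def by (rule exit_time_nonneg[OF \<omega> a b exits])
  have u: "0 \<le> u" by (simp add: u_def)
  have "real (min (Suc n * Suc n) (nat \<lfloor>t * real (Suc n)\<rfloor> + 1)) \<le> real (nat \<lfloor>t * real (Suc n)\<rfloor>) + 1"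
    by simp
  also have "\<dots> \<le> t * real (Suc n) + 1"
    using t by (simp add: of_nat_nat del: of_nat_Suc)
  also have "\<dots> \<le> (t + 1) * real (Suc n)" by (simp add: algebra_simps)
  finally have ut: "u \<le> t + 1"
    unfolding u_def by (subst pos_divide_le_eq) simp_all
  have "\<bar>level c u \<omega>\<bar> \<le> a + b + norm c"
  proof (cases "u < t")
    case True
    then have "level c u \<omega> \<in> {-a..b}"
      using level_before_exit[OF \<omega> a b exits u] unfolding t_def by blast
    then have "-a \<le> level c u \<omega>" "level c u \<omega> \<le> b" by simp_all
    then show ?thesis using a b norm_ge_zero[of c] by linarith
  next
    case False
    then have "\<bar>level c u \<omega> - level c t \<omega>\<bar> \<le> norm c * (u - t)"
      by (intro level_Lipschitz[OF \<omega> t]) simp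
    also have "\<dots> \<le> norm c * 1" using ut by (intro mult_left_mono) auto
    finally have "\<bar>level c u \<omega> - level c t \<omega>\<bar> \<le> norm c" by simp
    moreover have "level c t \<omega> \<in> {-a..b}"
      unfolding t_def by (rule level_at_exit[OF \<omega> a b exits])
    ultimately show ?thesis using a b by (auto simp: abs_le_iff)
  qed
  moreover have "\<bar>h $ \<phi> u \<omega>\<bar> \<le> norm h" by (rule component_le_norm_cart)
  ultimately show ?thesis
    unfolding stopped_sum_eq u_def[symmetric] t_def[symmetric] drift_martingale_def by linarith
qed

lemma stopped_sum_tendsto:
  "(\<lambda>n. stopped_sum c h a b n \<omega>) \<longlonglongrightarrow> drift_martingale c h (exit_time c a b \<omega>) \<omega>"
proof -
  define t where "t = exit_time c a b \<omega>"
  define g where "g n = (of_int \<lfloor>t * real (Suc n)\<rfloor> + 1) / real (Suc n)" for n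
  have t: "0 \<le> t" unfolding t_def by (rule exit_time_nonneg[OF \<omega> a b exits])
  have g: "filterlim g (at_right t) sequentially"
    unfolding g_def[abs_def] by (rule filterlim_grid_at_right[OF filterlim_real_Suc_at_top])
  have "(\<lambda>n. level c (g n) \<omega>) \<longlonglongrightarrow> level c t \<omega>"
    by (rule filterlim_compose[OF tendsto_level_right[OF \<omega> t] g])
  moreover have "(\<lambda>n. h $ \<phi> (g n) \<omega>) \<longlonglongrightarrow> h $ \<phi> t \<omega>"
  proof (rule tendsto_eventually)
    show "\<forall>\<^sub>F n in sequentially. h $ \<phi> (g n) \<omega> = h $ \<phi> t \<omega>"
      using eventually_phase_grid[OF \<omega> t filterlim_real_Suc_at_top]
      unfolding g_def by eventually_elim simp
  qed
  ultimately have lim: "(\<lambda>n. drift_martingale c h (g n) \<omega>) \<longlonglongrightarrow> drift_martingale c h t \<omega>"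
    unfolding drift_martingale_def by (rule tendsto_add)
  \<comment> \<open>From t + 1 \<le> n + 1 on, the cap at time n + 1 is inactive and the stopped
    time is the rounded exit time.\<close>
  have "\<forall>\<^sub>F n in sequentially. t + 1 \<le> real (Suc n)"
    using filterlim_real_Suc_at_top unfolding filterlim_at_top by blast
  then have "\<forall>\<^sub>F n in sequentially. drift_martingale c h (g n) \<omega> = stopped_sum c h a b n \<omega>"
  proof eventually_elim
    case (elim n)
    let ?L = "nat \<lfloor>t * real (Suc n)\<rfloor> + 1"
    have "0 \<le> \<lfloor>t * real (Suc n)\<rfloor>" using t by simp
    then have L: "real ?L = of_int \<lfloor>t * real (Suc n)\<rfloor> + 1" by simp
    have "real ?L \<le> t * real (Suc n) + 1" unfolding L by linarith
    also have "\<dots> \<le> (t + 1) * real (Suc n)" by (simp add: algebra_simps)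
    also have "\<dots> \<le> real (Suc n) * real (Suc n)" using elim by (intro mult_right_mono) auto
    finally have "real ?L \<le> real (Suc n * Suc n)" by (simp only: of_nat_mult)
    then have "min (Suc n * Suc n) ?L = ?L" by (simp only: of_nat_le_iff min.absorb2)
    then show ?case unfolding stopped_sum_eq t_def[symmetric] g_def L[symmetric] by simp
  qed
  then show ?thesis
    unfolding t_def[symmetric] by (rule Lim_transform_eventually[OF lim])
qed

text \<open>Exactly one of the passage events contains \<omega>, the one with the direction of the
  exit and the phase at that instant, so both sums collapse to a single value of \<beta>.\<close>

lemma drift_martingale_at_exit:
  fixes h \<beta> :: "real^'s"
  assumes up: "\<And>j. 0 < c $ j \<Longrightarrow> \<beta> $ j = b + h $ j"
    and down: "\<And>j. c $ j < 0 \<Longrightarrow> \<beta> $ j = - a + h $ j"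
  shows "drift_martingale c h (exit_time c a b \<omega>) \<omega> =
    (\<Sum>j\<in>S_plus c. indicator (passage_event c a b j) \<omega> * \<beta> $ j) +
    (\<Sum>j\<in>S_minus c. indicator (passage_event (- c) b a j) \<omega> * \<beta> $ j)"
proof -
  define t where "t = exit_time c a b \<omega>"
  define k where "k = \<phi> t \<omega>"
  consider "0 < c $ k" | "c $ k < 0"
    using exit_rate_nonzero[OF \<omega> a b exits] unfolding k_def t_def by linarith
  then show ?thesis
  proof cases
    case 1
    note e = exit_upwards[OF \<omega> a b exits, folded t_def, folded k_def, OF 1]
    have "indicator (passage_event c a b j) \<omega> * \<beta> $ j = (if j = k then \<beta> $ k else 0)" for j
      using e \<omega> by (auto simp: passage_event_def k_def)
    moreover have "\<omega> \<notin> passage_event (- c) b a j" for j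
      using less_not_sym[OF e(3)] e(2) by (simp add: passage_event_def)
    ultimately show ?thesis
      using 1 e up[OF 1] by (simp add: S_plus_def drift_martingale_def flip: t_def k_def)
  next
    case 2
    note e = exit_downwards[OF \<omega> a b exits, folded t_def, folded k_def, OF 2]
    have "indicator (passage_event (- c) b a j) \<omega> * \<beta> $ j = (if j = k then \<beta> $ k else 0)" for j
      using e \<omega> by (auto simp: passage_event_def k_def)
    moreover have "\<omega> \<notin> passage_event c a b j" for j
      using less_not_sym[OF e(3)] e(2) by (simp add: passage_event_def)
    ultimately show ?thesis
      using 2 e down[OF 2] by (simp add: S_minus_def drift_martingale_def flip: t_def k_def)
  qed
qed

end

text \<open>The means of the stopped sums do not depend on n, while the sums themselves converge
  boundedly to the exit value. The initial distribution is arbitrary here, hence the expectation of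
  h at the initial phase on the right.\<close>

theorem expected_exit_value:
  fixes c h \<beta> :: "real^'s"
  assumes irr: "irreducible_generator Q" and h: "Q *v h = - c" and k: "0 < c $ k"
    and a: "0 \<le> a" and b: "0 \<le> b"
    and \<beta>: "\<And>j. 0 < c $ j \<Longrightarrow> \<beta> $ j = b + h $ j" "\<And>j. c $ j < 0 \<Longrightarrow> \<beta> $ j = - a + h $ j"
  shows "(\<Sum>j\<in>S_plus c. prob (passage_event c a b j) * \<beta> $ j) +
    (\<Sum>j\<in>S_minus c. prob (passage_event (- c) b a j) * \<beta> $ j) = (LINT \<omega>|M. h $ \<phi> 0 \<omega>)"
proof -
  define F where "F \<omega> = (\<Sum>j\<in>S_plus c. indicator (passage_event c a b j) \<omega> * \<beta> $ j) +
    (\<Sum>j\<in>S_minus c. indicator (passage_event (- c) b a j) \<omega> * \<beta> $ j)" for \<omega>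
  have [measurable]: "passage_event c a b j \<in> sets M" "passage_event (- c) b a j \<in> sets M" for j
    by (rule sets_passage_event)+
  have ex: "AE \<omega> in M. \<exists>t\<ge>0. level c t \<omega> \<notin> {-a..b}"
    by (rule AE_exits[OF irr k a b])
  have "(\<lambda>n. LINT \<omega>|M. stopped_sum c h a b n \<omega>) \<longlonglongrightarrow> (LINT \<omega>|M. F \<omega>)"
  proof (rule integral_dominated_convergence)
    show "F \<in> borel_measurable M" unfolding F_def[abs_def] by measurable
    show "stopped_sum c h a b n \<in> borel_measurable M" for n
      using integral_stopped_sum(2)[OF h] by (rule borel_measurable_integrable)
    show "integrable M (\<lambda>\<omega>. a + b + norm c + norm h)" by simp
    show "AE \<omega> in M. (\<lambda>n. stopped_sum c h a b n \<omega>) \<longlonglongrightarrow> F \<omega>"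
      using ex AE_space
    proof eventually_elim
      case (elim \<omega>)
      show ?case
        using stopped_sum_tendsto[OF elim(2) a b elim(1), of h]
          drift_martingale_at_exit[OF elim(2) a b elim(1) \<beta>] by (simp add: F_def)
    qed
    show "AE \<omega> in M. norm (stopped_sum c h a b n \<omega>) \<le> a + b + norm c + norm h" for n
      using ex AE_space
    proof eventually_elim
      case (elim \<omega>)
      show ?case using abs_stopped_sum_le[OF elim(2) a b elim(1)] by simp
    qed
  qed
  then have "(LINT \<omega>|M. F \<omega>) = (LINT \<omega>|M. h $ \<phi> 0 \<omega>)"
    unfolding integral_stopped_sum(1)[OF h] by (rule LIMSEQ_unique[OF _ tendsto_const])
  moreover have "(LINT \<omega>|M. F \<omega>) = (\<Sum>j\<in>S_plus c. prob (passage_event c a b j) * \<beta> $ j) +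
    (\<Sum>j\<in>S_minus c. prob (passage_event (- c) b a j) * \<beta> $ j)"
  proof -
    have I: "integrable M (\<lambda>\<omega>. indicator A \<omega> * x :: real)" if "A \<in> sets M" for A x
      using that by (simp add: emeasure_eq_measure)
    have "(LINT \<omega>|M. indicator A \<omega> * x :: real) = prob A * x" if "A \<in> sets M" for A x
      using that by simp
    then show ?thesis
      unfolding F_def
      by (simp only: Bochner_Integration.integral_add Bochner_Integration.integral_sum
          Bochner_Integration.integrable_sum I sets_passage_event)
  qed
  ultimately show ?thesis by simp
qed

end

lemma markov_chain_imp_markov_process:
  assumes "markov_chain Q M \<phi>"
  shows "markov_process M \<phi> Q"
proof -
  note mc = assms[unfolded markov_chain_def]
  note meas = mc[THEN conjunct2, THEN conjunct1]
    and const = mc[THEN conjunct2, THEN conjunct2, THEN conjunct1]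
    and mkv = mc[THEN conjunct2, THEN conjunct2, THEN conjunct2]
  have rcp: "right_constant_process M \<phi>"
    by (intro right_constant_process.intro meas[rule_format] const[rule_format])
  have "markov_process_axioms M \<phi> Q"
  proof (intro markov_process_axioms.intro mkv[rule_format])
    fix s E assume "E \<in> sets (right_constant_process.past M \<phi> s)"
    then show "E \<in> history M \<phi> s"
      by (simp only: right_constant_process.sets_past[OF rcp])
  qed
  with mc[THEN conjunct1] rcp show ?thesis by (rule markov_process.intro)
qed

theorem lemma8p3:
  fixes Q G :: "real^'s^'s"
    and c \<alpha> h \<beta> :: "real^'s"
    and P :: "'s \<Rightarrow> 'w measure"
    and X :: "real \<Rightarrow> 'w \<Rightarrow> real"
    and \<phi> :: "real \<Rightarrow> 'w \<Rightarrow> 's"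
    and a b :: real
  assumes "irreducible_generator Q"
    and "S_plus c \<noteq> {}"
    and "S_minus c \<noteq> {}"
    and "fluid_flow_family Q c P X \<phi>"
    and "stationary_vector Q \<alpha>"
    and "group_inverse Q \<alpha> G"
    and "0 \<le> a"
    and "0 \<le> b"
    and "\<alpha> \<bullet> c = 0"
    and "h = - (G *v c)"
    and "\<And>j. j \<in> S_plus c \<Longrightarrow> \<beta> $ j = b + h $ j"
    and "\<And>j. j \<in> S_minus c \<Longrightarrow> \<beta> $ j = - a + h $ j"
  shows "(\<forall>i\<in>S_plus c.
            (\<Sum>j\<in>S_plus c. escape_B P X \<phi> a b i j * \<beta> $ j) +
            (\<Sum>j\<in>S_minus c. escape_A P X \<phi> a b i j * \<beta> $ j) = h $ i) \<and>
         (\<forall>i\<in>S_minus c.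
            (\<Sum>j\<in>S_plus c. escape_B P X \<phi> a b i j * \<beta> $ j) +
            (\<Sum>j\<in>S_minus c. escape_A P X \<phi> a b i j * \<beta> $ j) = h $ i)"
proof -
  obtain k where k: "0 < c $ k" using assms(2) by (auto simp: S_plus_def)
  have h: "Q *v h = - c"
    using group_inverse_solves_Poisson[OF assms(5,6,9)] assms(10)
    by (simp add: linear_neg[OF matrix_vector_mul_linear])
  \<comment> \<open>The identity is obtained for every starting phase i; the two row blocks of the
    claim are instances.\<close>
  have "(\<Sum>j\<in>S_plus c. escape_B P X \<phi> a b i j * \<beta> $ j) +
        (\<Sum>j\<in>S_minus c. escape_A P X \<phi> a b i j * \<beta> $ j) = h $ i" for i
  proof -
    have ff: "fluid_flow Q c (P i) X \<phi>" and start: "AE \<omega> in P i. X 0 \<omega> = 0 \<and> \<phi> 0 \<omega> = i"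
      using assms(4)[unfolded fluid_flow_family_def] by blast+
    note ff = ff[unfolded fluid_flow_def]
    interpret markov_process "P i" \<phi> Q
      by (rule markov_chain_imp_markov_process[OF ff[THEN conjunct1]])
    \<comment> \<open>Passage times compare the level with its own start, so X 0 cancels and they
      become passage times of \<open>level\<close> on every path, not just almost surely.\<close>
    have Xl: "X t \<omega> = X 0 \<omega> + level c t \<omega>" if "\<omega> \<in> space (P i)" "0 \<le> t" for \<omega> t
      unfolding level_def by (rule ff[THEN conjunct2, THEN conjunct2, rule_format, OF that])
    have up: "tau_up X b \<omega> = first_passage c b \<omega>" if "\<omega> \<in> space (P i)" for \<omega>
    proof -
      have "0 \<le> t \<and> X t \<omega> > X 0 \<omega> + b \<longleftrightarrow> 0 \<le> t \<and> b < level c t \<omega>" for t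
        using Xl[OF that, of t] by auto
      then show ?thesis by (simp only: tau_up_def first_passage_def)
    qed
    have down: "tau_down X a \<omega> = first_passage (- c) a \<omega>" if "\<omega> \<in> space (P i)" for \<omega>
    proof -
      have "0 \<le> t \<and> X t \<omega> < X 0 \<omega> - a \<longleftrightarrow> 0 \<le> t \<and> a < level (- c) t \<omega>" for t
        using Xl[OF that, of t] by (auto simp: level_uminus)
      then show ?thesis by (simp only: tau_down_def first_passage_def)
    qed
    have B: "escape_B P X \<phi> a b i j = prob (passage_event c a b j)" for j
      unfolding escape_B_def passage_event_def
      by (intro arg_cong[where f = prob] Collect_cong conj_cong refl) (simp_all add: up down)
    have A: "escape_A P X \<phi> a b i j = prob (passage_event (- c) b a j)" for j
      unfolding escape_A_def passage_event_def
      by (intro arg_cong[where f = prob] Collect_cong conj_cong refl) (simp_all add: up down)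
    have "(LINT \<omega>|P i. h $ \<phi> 0 \<omega>) = (LINT \<omega>|P i. h $ i)"
    proof (rule integral_cong_AE)
      show "AE \<omega> in P i. h $ \<phi> 0 \<omega> = h $ i"
        using start by eventually_elim simp
    qed (auto intro: measurable_phase_component)
    then show ?thesis
      using expected_exit_value[OF assms(1) h k assms(7,8), of \<beta>] assms(11,12)
      by (simp add: A B S_plus_def S_minus_def prob_space)
  qed
  then show ?thesis by blast
qed

end
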